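(* Let $\mu\ge\nu\ge-1$ be integers of the same parity, not both equal to $-1$, let $j\in\{0,1,2,\ldots\}$, and let $u$ be a non-zero $L^2$-solution of $D_{\mu,\nu}u=4j(j+\mu+1)u$ on $(0,\infty)$. Let $A_j^{\mu,\nu}(u)$ and $B_j^{\mu,\nu}(u)$ be the constants associated with $u$ (defined in the context). Then $$\frac{A_j^{\mu,\nu}(u)}{B_j^{\mu,\nu}(u)} = (-1)^j\,\frac{j!\,2^{2\mu+\nu}\,\Gamma(\frac{\mu+2}{2})\,\Gamma(\frac{\mu-|\nu|+2}{2})\,\Gamma(j+\frac{\mu-\nu+2}{2})}{\Gamma(j+\frac{\mu-|\nu|+2}{2})\,\pi\,\Gamma(j+\mu+1)}\times c_\nu,$$ where $c_\nu=\frac{2}{\Gamma(\nu/2)}$ if $\nu>0$, $c_\nu=-1$ if $\nu=0$, and $c_\nu=-\frac{2}{\Gamma(\nu/2)}$ if $\nu=-1$.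
   Context: Let $\theta=x\frac{\mathrm{d}}{\mathrm{d}x}$. The fourth order differential operator is $D_{\mu,\nu}=\frac{1}{x^2}\left((\theta+\mu)(\theta+\mu+\nu)-x^2\right)\left(\theta(\theta+\nu)-x^2\right)$. $L^2$-solutions: it is known that (for $\mu,\nu$ as in the claim) $D_{\mu,\nu}$ extends to a self-adjoint operator on $L^2(\mathbb{R}_+,x^{\mu+\nu+1}\mathrm{d}x)$, $\mathbb{R}_+=(0,\infty)$, with purely discrete spectrum $\lambda_j^{\mu,\nu}=4j(j+\mu+1)$, $j=0,1,2,\ldots$, and one-dimensional eigenspaces. An "$L^2$-solution" of $D_{\mu,\nu}u=\lambda_j^{\mu,\nu}u$ is an element of the corresponding eigenspace. It is known that this eigenspace is spanned by the real analytic function $\Lambda_j^{\mu,\nu}$ on $\mathbb{R}_+$ defined by the power series expansion in $t$ around $t=0$ $$\frac{1}{(1-t)^{\frac{\mu+\nu+2}{2}}}\widetilde{I}_{\frac{\mu}{2}}\left(\frac{tx}{1-t}\right)\widetilde{K}_{\frac{\nu}{2}}\left(\frac{x}{1-t}\right)=\sum_{j=0}^\infty\Lambda_j^{\mu,\nu}(x)t^j,$$ so the $L^2$-solutions are exactly the scalar multiples of $\Lambda_j^{\mu,\nu}$. Normalized special functions: $\widetilde{J}_\alpha(z)=(\frac z2)^{-\alpha}J_\alpha(z)$ (extended to an even entire function), $\widetilde{I}_\alpha(z)=(\frac z2)^{-\alpha}I_\alpha(z)$ (likewise extended), $\widetilde{K}_\alpha(z)=(\frac z2)^{-\alpha}K_\alpha(z)$,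 where $J_\alpha,I_\alpha,K_\alpha$ are the usual Bessel and modified Bessel functions. $\widetilde{C}_n^\lambda(x)=\Gamma(\lambda)C_n^\lambda(x)$ is the normalized Gegenbauer polynomial; for $\lambda=0$ and $n\ge1$ it is understood as the limit $\lambda\to0$, i.e. $\widetilde{C}_n^0(\cos\varphi)=\frac{2}{n}\cos(n\varphi)$. Definition of $A_j^{\mu,\nu}(u)$: for an $L^2$-solution $u$, $A_j^{\mu,\nu}(u)$ is the (unique) constant such that for all real $\vartheta,\varphi$ with $\cos\vartheta+\cos\varphi>0$, with $a:=\frac{\sin\vartheta}{\cos\vartheta+\cos\varphi}$ and $b:=\frac{\sin\varphi}{\cos\vartheta+\cos\varphi}$, $$\int_0^\infty u(x)\widetilde{J}_{\frac{\mu}{2}}(ax)\widetilde{J}_{\frac{\nu}{2}}(bx)x^{\mu+\nu+1}\mathrm{d}x = A_j^{\mu,\nu}(u)\left(\frac{\cos\vartheta+\cos\varphi}{2}\right)^{\frac{\mu+\nu+2}{2}}\widetilde{C}_j^{\frac{\mu+1}{2}}(\cos\vartheta)\widetilde{C}_{j+\frac{\mu-\nu}{2}}^{\frac{\nu+1}{2}}(\cos\varphi).$$ Definition of $B_j^{\mu,\nu}(u)$: for a non-zero $L^2$-solution $u$, $B_j^{\mu,\nu}(u)$ is the non-zero constant determined by the asymptotic behaviour as $x\to0$: $u(x)=B_j^{\mu,\nu}(u)\,(x^{-\nu}+o(x^{-\nu}))$ if $\nu>0$; $u(x)=B_j^{\mu,\nu}(u)\,(\log(\frac x2)+o(\log(\frac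 x2)))$ if $\nu=0$; $u(x)=B_j^{\mu,\nu}(u)\,(1+o(1))$ if $\nu=-1$. (Existence of both constants is known.) *)

theory Defs
  imports "HOL-Analysis.Analysis" "HOL-Library.Landau_Symbols"
begin

text \<open>The power series of \<open>(z/2)\<^sup>-\<^sup>\<alpha> J\<^sub>\<alpha>(z)\<close>; it provides the even entire extension
  to \<open>z \<le> 0\<close>. The same convention is used for \<open>I\<^sub>\<alpha>\<close>.\<close>

definition J_norm :: "real \<Rightarrow> real \<Rightarrow> real" where
  "J_norm \<alpha> z = (\<Sum>k. (-1) ^ k * rGamma (real k + \<alpha> + 1) / fact k * (z / 2) ^ (2 * k))"

definition bessel_J :: "real \<Rightarrow> real \<Rightarrow> real" where
  "bessel_J \<alpha> z = (z / 2) powr \<alpha> * J_norm \<alpha> z"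

definition I_norm :: "real \<Rightarrow> real \<Rightarrow> real" where
  "I_norm \<alpha> z = (\<Sum>k. rGamma (real k + \<alpha> + 1) / fact k * (z / 2) ^ (2 * k))"

definition bessel_I :: "real \<Rightarrow> real \<Rightarrow> real" where
  "bessel_I \<alpha> z = (z / 2) powr \<alpha> * I_norm \<alpha> z"

lemma J_norm_eq: "J_norm \<alpha> z = (z / 2) powr (-\<alpha>) * bessel_J \<alpha> z" if "z > 0"
  using that by (simp add: bessel_J_def flip: mult.assoc powr_add)

lemma I_norm_eq: "I_norm \<alpha> z = (z / 2) powr (-\<alpha>) * bessel_I \<alpha> z" if "z > 0"
  using that by (simp add: bessel_I_def flip: mult.assoc powr_add)

text \<open>The modified Bessel function of the second kind on \<open>z > 0\<close>. The Schlaefli integral is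
  used because, unlike \<open>\<pi>/2 (I\<^sub>-\<^sub>\<alpha>(z) - I\<^sub>\<alpha>(z)) / sin (\<pi>\<alpha>)\<close>, it needs no limit at integral \<open>\<alpha>\<close>.\<close>

definition bessel_K :: "real \<Rightarrow> real \<Rightarrow> real" where
  "bessel_K \<alpha> z = (LBINT t:{0..}. exp (- z * cosh t) * cosh (\<alpha> * t))"

definition K_norm :: "real \<Rightarrow> real \<Rightarrow> real" where
  "K_norm \<alpha> z = (z / 2) powr (-\<alpha>) * bessel_K \<alpha> z"

fun gegenbauer :: "nat \<Rightarrow> real \<Rightarrow> real \<Rightarrow> real" where
  "gegenbauer 0 l x = 1"
| "gegenbauer (Suc 0) l x = 2 * l * x"
| "gegenbauer (Suc (Suc n)) l x =
     (2 * x * (real n + 1 + l) * gegenbauer (Suc n) l x - (real n + 2 * l) * gegenbauer n l x)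
       / (real n + 2)"

text \<open>At parameter \<open>0\<close> the limit exists for degree \<open>n \<ge> 1\<close> only, where it is
  \<open>2/n cos (n \<phi>)\<close> at \<open>x = cos \<phi>\<close>.\<close>

definition gegenbauer_norm :: "nat \<Rightarrow> real \<Rightarrow> real \<Rightarrow> real" where
  "gegenbauer_norm n l x =
     (if l = 0 then Lim (at 0) (\<lambda>s. Gamma s * gegenbauer n s x) else Gamma l * gegenbauer n l x)"

definition Lambda_gen :: "int \<Rightarrow> int \<Rightarrow> real \<Rightarrow> real \<Rightarrow> real" where
  "Lambda_gen \<mu> \<nu> x t =
     1 / (1 - t) powr (of_int (\<mu> + \<nu> + 2) / 2)
       * I_norm (of_int \<mu> / 2) (t * x / (1 - t)) * K_norm (of_int \<nu> / 2) (x / (1 - t))"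

text \<open>The coefficient of \<open>t\<^sup>j\<close> in the expansion of \<^term>\<open>Lambda_gen \<mu> \<nu> x\<close> around \<open>t = 0\<close>.\<close>

definition Lambda :: "int \<Rightarrow> int \<Rightarrow> nat \<Rightarrow> real \<Rightarrow> real" where
  "Lambda \<mu> \<nu> j x = (deriv ^^ j) (Lambda_gen \<mu> \<nu> x) 0 / fact j"

definition theta_plus :: "int \<Rightarrow> (real \<Rightarrow> complex) \<Rightarrow> real \<Rightarrow> complex" where
  "theta_plus c f x = of_real x * vector_derivative f (at x) + of_int c * f x"

definition D_op :: "int \<Rightarrow> int \<Rightarrow> (real \<Rightarrow> complex) \<Rightarrow> real \<Rightarrow> complex" where
  "D_op \<mu> \<nu> f =
     (let g = (\<lambda>x. theta_plus 0 (theta_plus \<nu> f) x - of_real (x\<^sup>2) * f x)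
      in (\<lambda>x. (theta_plus \<mu> (theta_plus (\<mu> + \<nu>) g) x - of_real (x\<^sup>2) * g x) / of_real (x\<^sup>2)))"

text \<open>\<open>C\<^sub>c\<^sup>\<infinity>\<close> functions on \<open>(0,\<infinity>)\<close>, extended by zero to the real line.\<close>

definition test_fun :: "(real \<Rightarrow> complex) \<Rightarrow> bool" where
  "test_fun f \<longleftrightarrow>
     (\<forall>n x. ((\<lambda>g y. vector_derivative g (at y)) ^^ n) f differentiable (at x)) \<and>
     (\<exists>K. compact K \<and> K \<subseteq> {0<..} \<and> (\<forall>x. x \<notin> K \<longrightarrow> f x = 0))"

definition wmeasure :: "int \<Rightarrow> int \<Rightarrow> real measure" where
  "wmeasure \<mu> \<nu> =
     density (restrict_space lborel {0<..}) (\<lambda>x. ennreal (x powr of_int (\<mu> + \<nu> + 1)))"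

definition L2_space :: "'a measure \<Rightarrow> ('a \<Rightarrow> complex) set" where
  "L2_space M = {f \<in> borel_measurable M. integrable M (\<lambda>x. (cmod (f x))\<^sup>2)}"

definition L2_inner :: "'a measure \<Rightarrow> ('a \<Rightarrow> complex) \<Rightarrow> ('a \<Rightarrow> complex) \<Rightarrow> complex" where
  "L2_inner M f g = (LINT x|M. f x * cnj (g x))"

text \<open>Unbounded operators on \<open>L\<^sup>2(M)\<close> are given by their graphs, as sets of pairs of representatives.
  The right-hand side below is the graph of the adjoint. An equality forces \<open>T\<close> to be linear and
  closed under almost everywhere equality, and, if the domain is dense, single-valued up to it.\<close>

definition self_adjoint :: "'a measure \<Rightarrow> (('a \<Rightarrow> complex) \<times> ('a \<Rightarrow> complex)) set \<Rightarrow> bool" where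
  "self_adjoint M T \<longleftrightarrow>
     T = {(f, g). f \<in> L2_space M \<and> g \<in> L2_space M \<and> (\<forall>(h, k)\<in>T. L2_inner M g h = L2_inner M f k)}"

definition eigenspace ::
    "(('a \<Rightarrow> complex) \<times> ('a \<Rightarrow> complex)) set \<Rightarrow> complex \<Rightarrow> ('a \<Rightarrow> complex) set" where
  "eigenspace T l = {f. (f, \<lambda>x. l * f x) \<in> T}"

definition D_eigenvalue :: "int \<Rightarrow> nat \<Rightarrow> int" where
  "D_eigenvalue \<mu> j = 4 * int j * (int j + \<mu> + 1)"

text \<open>For small parameters the restriction of \<^const>\<open>D_op\<close> to test functions is not essentially
  self-adjoint (for \<open>\<mu> = \<nu> = 0\<close> all four solutions of the eigenvalue equation are square-integrable
  at \<open>0\<close>). The extension is therefore singled out by its eigenfunctions.\<close>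

definition D_realization ::
    "int \<Rightarrow> int \<Rightarrow> ((real \<Rightarrow> complex) \<times> (real \<Rightarrow> complex)) set \<Rightarrow> bool" where
  "D_realization \<mu> \<nu> T \<longleftrightarrow>
     self_adjoint (wmeasure \<mu> \<nu>) T \<and>
     (\<forall>f. test_fun f \<longrightarrow> (f, D_op \<mu> \<nu> f) \<in> T) \<and>
     (\<forall>k. eigenspace T (of_int (D_eigenvalue \<mu> k)) =
        {f \<in> borel_measurable (wmeasure \<mu> \<nu>).
           \<exists>c. AE x in wmeasure \<mu> \<nu>. f x = c * of_real (Lambda \<mu> \<nu> k x)})"

text \<open>Continuity selects the regular representative, which the pointwise asymptotics at \<open>0\<close>
  refer to.\<close>

definition L2_solution ::
    "int \<Rightarrow> int \<Rightarrow> ((real \<Rightarrow> complex) \<times> (real \<Rightarrow> complex)) set \<Rightarrow> nat \<Rightarrow> (real \<Rightarrow> complex) \<Rightarrow> bool" where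
  "L2_solution \<mu> \<nu> T j u \<longleftrightarrow>
     u \<in> eigenspace T (of_int (D_eigenvalue \<mu> j)) \<and> continuous_on {0<..} u"

definition is_const_A :: "int \<Rightarrow> int \<Rightarrow> nat \<Rightarrow> (real \<Rightarrow> complex) \<Rightarrow> complex \<Rightarrow> bool" where
  "is_const_A \<mu> \<nu> j u A \<longleftrightarrow>
     (\<forall>\<theta> \<phi> :: real. cos \<theta> + cos \<phi> > 0 \<longrightarrow>
        (let a = sin \<theta> / (cos \<theta> + cos \<phi>);
             b = sin \<phi> / (cos \<theta> + cos \<phi>);
             F = (\<lambda>x. u x * of_real (J_norm (of_int \<mu> / 2) (a * x))
                          * of_real (J_norm (of_int \<nu> / 2) (b * x)))
         in integrable (wmeasure \<mu> \<nu>) F \<and>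
            (LINT x|wmeasure \<mu> \<nu>. F x) =
              A * of_real (((cos \<theta> + cos \<phi>) / 2) powr (of_int (\<mu> + \<nu> + 2) / 2)
                    * gegenbauer_norm j (of_int (\<mu> + 1) / 2) (cos \<theta>)
                    * gegenbauer_norm (nat (int j + (\<mu> - \<nu>) div 2)) (of_int (\<nu> + 1) / 2) (cos \<phi>))))"

definition B_profile :: "int \<Rightarrow> real \<Rightarrow> real" where
  "B_profile \<nu> x = (if \<nu> > 0 then x powr (- of_int \<nu>) else if \<nu> = 0 then ln (x / 2) else 1)"

definition is_const_B :: "int \<Rightarrow> (real \<Rightarrow> complex) \<Rightarrow> complex \<Rightarrow> bool" where
  "is_const_B \<nu> u B \<longleftrightarrow> B \<noteq> 0 \<and>
     (\<exists>r. r \<in> o[at_right 0](\<lambda>x. complex_of_real (B_profile \<nu> x)) \<and>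
          (\<forall>x>0. u x = B * (of_real (B_profile \<nu> x) + r x)))"

definition c_const :: "int \<Rightarrow> real" where
  "c_const \<nu> = (if \<nu> > 0 then 2 / Gamma (of_int \<nu> / 2)
               else if \<nu> = 0 then -1
               else - 2 / Gamma (of_int \<nu> / 2))"

end

theory Submission
  imports Defs "HOL-Probability.Distributions"
begin

text \<open>
  The eigenspace hypothesis makes \<open>u\<close> a multiple \<open>c \<Lambda>\<^sub>j\<close> of the coefficient function
  \<open>\<Lambda>\<^sub>j\<close>, first almost everywhere and then, both sides being continuous, on all of
  \<open>(0,\<infinity>)\<close>. Since \<open>A\<close> and \<open>B\<close> are both proportional to \<open>c\<close>, the quotient only depends on
  \<open>\<Lambda>\<^sub>j\<close>, and it is enough to compute \<open>A\<close> at one convenient point.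

  At \<open>\<theta> = \<phi> = 0\<close> both Bessel factors are constants, so \<open>A\<close> is determined by the moment
  \<open>\<integral> \<Lambda>\<^sub>j(x) x\<^bsup>\<mu>+\<nu>+1\<^esup> dx\<close> and by the values of the Gegenbauer polynomials at \<open>1\<close>. Put
  \<open>2m = \<mu> + \<nu>\<close> and substitute \<open>x \<mapsto> (1 - t) x\<close> in the integral of the generating function. Then
  the power series of \<open>I\<close> can be integrated termwise by the Mellin transform of \<open>K\<close>; the Gamma
  factors from \<open>I\<close> cancel, and what remains is
  \<open>4\<^sup>m m! (1-t)\<^bsup>m+1\<^esup> (1-t\<^sup>2)\<^bsup>-m-1\<^esup> = 4\<^sup>m m! (1+t)\<^bsup>-m-1\<^esup>\<close>. The moment is the coefficient
  of \<open>t\<^sup>j\<close>. For \<open>B\<close>, only the constant term of \<open>I\<close> contributes to the leading behaviour at \<open>x = 0\<close>,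
  and the leading term of \<open>K(x/(1-t))\<close> leaves the series \<open>(1-t)\<^bsup>-k-1\<^esup>\<close> with \<open>2k = \<mu> - |\<nu>|\<close>.

  Interchanging the extraction of the coefficient of \<open>t\<^sup>j\<close> with an integral or with a limit \<open>x \<rightarrow> 0\<close> is
  avoided altogether. As a function of the square of its argument, the normalized \<open>K\<close> has an explicit
  Taylor expansion whose coefficients are normalized \<open>K\<close> functions of higher order. Composing power
  series, \<open>\<Lambda>\<^sub>j(x)\<close> becomes a \<^emph>\<open>finite\<close> sum of terms \<open>x\<^bsup>p+2i\<^esup> K(x)\<close> (\<open>Lambda_eq_sum\<close>). Integrals
  and limits are then taken term by term, and the sums are recognized as coefficients of composed formal
  power series (\<open>sum_Lambda_weight\<close>), which carries out the manipulations with \<open>t\<close> above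
  at the level of formal power series (\<open>has_bochner_integral_Lambda\<close>, \<open>tendsto_Lambda_profile\<close>).
\<close>

section \<open>Power series expansions and composition\<close>

lemma fps_nth_eq_iterated_deriv:
  fixes f :: "real \<Rightarrow> real"
  assumes "f has_fps_expansion F"
  shows "(deriv ^^ n) f 0 / fact n = fps_nth F n"
  using assms
proof (induction n arbitrary: f F)
  case 0
  then have "eventually (\<lambda>z. eval_fps F z = f z) (nhds 0)"
    by (simp add: has_fps_expansion_def)
  then have "eval_fps F 0 = f 0" by (rule eventually_nhds_x_imp_x)
  then show ?case by (simp add: eval_fps_at_0)
next
  case (Suc n)
  have "deriv f has_fps_expansion fps_deriv F"
    using Suc.prems by (rule has_fps_expansion_deriv)
  from Suc.IH[OF this] show ?case
    by (simp add: funpow_Suc_right divide_simps del: funpow.simps)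
qed

lemma abs_fps_power_nth_le:
  fixes D :: "real fps"
  shows "\<bar>fps_nth (D ^ i) n\<bar> \<le> fps_nth (Abs_fps (\<lambda>n. \<bar>fps_nth D n\<bar>) ^ i) n"
proof (induction i arbitrary: n)
  case (Suc i)
  show ?case
    unfolding power_Suc fps_mult_nth
    by (rule order.trans[OF sum_abs], rule sum_mono)
       (auto simp: abs_mult intro!: mult_mono Suc.IH)
qed simp

lemma sums_imp_has_sum_real:
  fixes f :: "nat \<Rightarrow> real"
  assumes "summable (\<lambda>n. \<bar>f n\<bar>)" "f sums s"
  shows "(f has_sum s) UNIV"
  using norm_summable_imp_has_sum[OF _ assms(2)] assms(1) by simp

text \<open>The double series \<open>\<Sum>i n. A\<^sub>i (D\<^sup>i)\<^sub>n u\<^sup>n\<close> sums to \<open>f (g u)\<close> by rows and to the formal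
  composition by columns. It converges absolutely for small \<open>u\<close>, because replacing the
  coefficients of \<open>D\<close> by their absolute values majorizes those of every power \<open>D\<^sup>i\<close>, and the majorant, which
  vanishes at \<open>0\<close>, stays below a radius on which \<open>A\<close> converges.\<close>

lemma has_fps_expansion_compose:
  fixes f g :: "real \<Rightarrow> real"
  assumes f: "f has_fps_expansion A" and g: "g has_fps_expansion D" and D0: "fps_nth D 0 = 0"
  shows "(\<lambda>x. f (g x)) has_fps_expansion (A oo D)"
proof (rule has_fps_expansionI)
  define D' where "D' = Abs_fps (\<lambda>n. \<bar>fps_nth D n\<bar>)"
  have rA: "fps_conv_radius A > 0" and rD: "fps_conv_radius D > 0"
    using f g by (auto simp: has_fps_expansion_def)
  have rD': "fps_conv_radius D' = fps_conv_radius D"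
    using fps_conv_radius_norm[of D] by (simp add: D'_def)
  have ex: "eval_fps D' has_fps_expansion D'"
    by (rule eval_fps_has_fps_expansion) (use rD rD' in auto)
  obtain r where r: "r > 0" "ereal r < fps_conv_radius A"
                    "\<And>y. \<bar>y\<bar> < r \<Longrightarrow> eval_fps A y = f y"
  proof -
    from f obtain d where d: "d > 0" "\<And>y. \<bar>y\<bar> < d \<Longrightarrow> eval_fps A y = f y"
      unfolding has_fps_expansion_def eventually_nhds_metric by (auto simp: dist_real_def)
    obtain e where e: "0 < ereal e" "ereal e < fps_conv_radius A"
      using ereal_dense2[OF rA] by auto
    show ?thesis
    proof (rule that[of "min d e"])
      show "ereal (min d e) < fps_conv_radius A"
        by (rule le_less_trans[OF _ e(2)]) simp
    qed (use d e in auto)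
  qed
  have "isCont (\<lambda>u. eval_fps D' \<bar>u\<bar>) 0"
  proof -
    have "isCont (eval_fps D') \<bar>0\<bar>"
      using has_fps_expansion_imp_continuous[OF ex, of UNIV] by simp
    then show ?thesis
      by (rule isCont_o2[where f = abs, rotated]) (intro continuous_intros)
  qed
  then have "((\<lambda>u. eval_fps D' \<bar>u\<bar>) \<longlongrightarrow> eval_fps D' \<bar>0\<bar>) (nhds 0)"
    unfolding isCont_def
    by (rule tendsto_at_iff_tendsto_nhds[where g = "\<lambda>u. eval_fps D' \<bar>u\<bar>", THEN iffD1])
  moreover have "eval_fps D' \<bar>0\<bar> < r"
    using r(1) D0 by (simp add: eval_fps_at_0 D'_def)
  ultimately have ev1: "eventually (\<lambda>u. eval_fps D' \<bar>u\<bar> < r) (nhds 0)"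
    by (rule order_tendstoD)
  have ev2: "eventually (\<lambda>u. u \<in> eball 0 (fps_conv_radius D)) (nhds 0)"
    using rD by (intro eventually_nhds_in_open) (auto simp: zero_ereal_def)
  have ev3: "eventually (\<lambda>u. eval_fps D u = g u) (nhds 0)"
    using g by (simp add: has_fps_expansion_def)
  show "eventually (\<lambda>u. (\<lambda>n. fps_nth (A oo D) n * u ^ n) sums f (g u)) (nhds 0)"
    using ev1 ev2 ev3
  proof eventually_elim
    case (elim u)
    define S where "S = eval_fps D' \<bar>u\<bar>"
    have u: "ereal \<bar>u\<bar> < fps_conv_radius D" using elim(2) by (simp add: dist_real_def)
    have rDi: "fps_conv_radius D \<le> fps_conv_radius (D ^ i)"
      and rDi': "fps_conv_radius D \<le> fps_conv_radius (D' ^ i)" for i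
      using fps_conv_radius_power[of D i] fps_conv_radius_power[of D' i] rD' by auto
    define F where "F = (\<lambda>i n. fps_nth A i * fps_nth (D ^ i) n * u ^ n)"
    have s': "(\<lambda>n. fps_nth (D' ^ i) n * \<bar>u\<bar> ^ n) sums (S ^ i)" for i
    proof -
      have "(\<lambda>n. fps_nth (D' ^ i) n * \<bar>u\<bar> ^ n) sums eval_fps (D' ^ i) \<bar>u\<bar>"
        by (rule sums_eval_fps) (use less_le_trans[OF u rDi'[of i]] in simp)
      also have "eval_fps (D' ^ i) \<bar>u\<bar> = S ^ i"
        unfolding S_def by (rule eval_fps_power) (use u rD' in auto)
      finally show ?thesis .
    qed
    have absb: "\<bar>fps_nth (D ^ i) n * u ^ n\<bar> \<le> fps_nth (D' ^ i) n * \<bar>u\<bar> ^ n" for i n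
      unfolding abs_mult power_abs
      by (intro mult_right_mono) (auto simp: D'_def abs_fps_power_nth_le)
    have absum: "summable (\<lambda>n. \<bar>fps_nth (D ^ i) n * u ^ n\<bar>)" for i
      by (rule summable_comparison_test'[of _ 0, OF sums_summable[OF s'[of i]]])
         (use absb in auto)
    have absle: "(\<Sum>n. \<bar>fps_nth (D ^ i) n * u ^ n\<bar>) \<le> S ^ i" for i
      using suminf_le[OF absb absum sums_summable[OF s']] sums_unique[OF s'] by simp
    have Snn: "0 \<le> S"
      unfolding S_def eval_fps_def by (rule suminf_nonneg) (use sums_summable[OF s'[of 1]] in \<open>auto simp: D'_def\<close>)
    have Sr: "S < r" using elim(1) by (simp add: S_def)
    have SrA: "ereal S < fps_conv_radius A"
      using Sr r(2) by (metis ereal_less(2) less_ereal.simps(1) less_trans)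
    have gS: "\<bar>g u\<bar> \<le> S"
    proof -
      have "(\<lambda>n. fps_nth D n * u ^ n) sums g u"
        using sums_eval_fps[of u D] u elim(3) by simp
      then have "\<bar>g u\<bar> \<le> (\<Sum>n. \<bar>fps_nth (D ^ 1) n * u ^ n\<bar>)"
        using summable_rabs[OF absum[of 1]] by (simp add: sums_iff)
      then show ?thesis using absle[of 1] by simp
    qed
    have row: "((\<lambda>n. F i n) has_sum (fps_nth A i * g u ^ i)) UNIV" for i
    proof -
      have "(\<lambda>n. fps_nth (D ^ i) n * u ^ n) sums eval_fps (D ^ i) u"
        by (rule sums_eval_fps) (use less_le_trans[OF u rDi[of i]] in simp)
      also have "eval_fps (D ^ i) u = g u ^ i"
        using elim(3) u by (subst eval_fps_power) auto
      finally have "((\<lambda>n. fps_nth (D ^ i) n * u ^ n) has_sum (g u ^ i)) UNIV"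
        by (intro sums_imp_has_sum_real absum)
      from has_sum_cmult_right[OF this, of "fps_nth A i"] show ?thesis
        by (simp add: F_def mult.assoc)
    qed
    have absrow: "((\<lambda>n. \<bar>F i n\<bar>) has_sum (\<bar>fps_nth A i\<bar> * (\<Sum>n. \<bar>fps_nth (D ^ i) n * u ^ n\<bar>))) UNIV" for i
    proof -
      have "((\<lambda>n. \<bar>fps_nth (D ^ i) n * u ^ n\<bar>) has_sum (\<Sum>n. \<bar>fps_nth (D ^ i) n * u ^ n\<bar>)) UNIV"
        by (rule sums_imp_has_sum_real) (use absum in \<open>auto simp: summable_sums\<close>)
      from has_sum_cmult_right[OF this, of "\<bar>fps_nth A i\<bar>"] show ?thesis
        by (simp add: F_def mult.assoc abs_mult)
    qed
    have absout: "(\<lambda>i. \<bar>fps_nth A i\<bar> * (\<Sum>n. \<bar>fps_nth (D ^ i) n * u ^ n\<bar>)) summable_on UNIV"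
    proof -
      have "summable (\<lambda>i. norm (fps_nth A i * S ^ i))"
        by (rule norm_summable_fps) (use Snn SrA in auto)
      then have 1: "summable (\<lambda>i. \<bar>fps_nth A i\<bar> * S ^ i)"
        using Snn by (simp add: abs_mult)
      have 2: "norm (\<bar>fps_nth A i\<bar> * (\<Sum>n. \<bar>fps_nth (D ^ i) n * u ^ n\<bar>)) \<le> \<bar>fps_nth A i\<bar> * S ^ i" for i
      proof -
        have "0 \<le> (\<Sum>n. \<bar>fps_nth (D ^ i) n * u ^ n\<bar>)"
          by (rule suminf_nonneg[OF absum]) simp
        then show ?thesis
          using mult_left_mono[OF absle[of i] abs_ge_zero[of "fps_nth A i"]]
          by (simp only: real_norm_def abs_of_nonneg mult_nonneg_nonneg abs_ge_zero)
      qed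
      have "summable (\<lambda>i. norm (\<bar>fps_nth A i\<bar> * (\<Sum>n. \<bar>fps_nth (D ^ i) n * u ^ n\<bar>)))"
        by (rule summable_comparison_test'[OF 1, of 0])
           (use 2 in \<open>simp only: real_norm_def abs_idempotent\<close>)
      then show ?thesis by (rule norm_summable_imp_summable_on)
    qed
    have "(\<lambda>(i, n). \<bar>F i n\<bar>) summable_on (SIGMA i:UNIV. UNIV)"
      by (rule summable_on_SigmaI[OF _ absout]) (use absrow in simp_all)
    then have "(\<lambda>(i, n). F i n) summable_on (SIGMA i:UNIV. UNIV)"
      using abs_summable_summable[of "\<lambda>(i, n). F i n"] by (simp add: case_prod_unfold)
    then obtain s where s: "((\<lambda>(i, n). F i n) has_sum s) (UNIV \<times> UNIV)"
      by (auto simp: summable_on_def)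
    have "(\<lambda>i. fps_nth A i * g u ^ i) sums s"
      by (rule has_sum_imp_sums, rule has_sum_SigmaD[OF s]) (use row in simp)
    moreover have "(\<lambda>i. fps_nth A i * g u ^ i) sums eval_fps A (g u)"
      by (rule sums_eval_fps) (use le_less_trans[OF _ SrA, of "ereal \<bar>g u\<bar>"] gS in auto)
    ultimately have sf: "s = f (g u)"
      using r(3)[of "g u"] gS Sr by (auto dest: sums_unique2)
    have "((\<lambda>(n, i). F i n) has_sum s) (UNIV \<times> UNIV)"
      using s by (subst (asm) has_sum_swap) simp
    moreover have "((\<lambda>i. F i n) has_sum (fps_nth (A oo D) n * u ^ n)) UNIV" for n
      by (rule has_sum_finite_neutralI[of "{0..n}"])
         (use D0 startsby_zero_power_prefix[of D] in
           \<open>auto simp: F_def fps_compose_nth sum_distrib_right\<close>)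
    ultimately have "((\<lambda>n. fps_nth (A oo D) n * u ^ n) has_sum s) UNIV"
      by (elim has_sum_SigmaD) simp
    then show ?case using sf by (auto intro: has_sum_imp_sums)
  qed
qed

text \<open>As \<open>D\<close> has no constant term, its powers beyond the \<open>j\<close>-th do not reach the coefficient of index \<open>j\<close>.
  Read from right to left, this turns the finite sums of this development into single coefficients.\<close>

lemma nth_compose_mult:
  fixes B D H :: "'a::comm_ring_1 fps"
  assumes "fps_nth D 0 = 0"
  shows "fps_nth ((B oo D) * H) j = (\<Sum>i\<le>j. fps_nth B i * fps_nth (D ^ i * H) j)"
proof -
  have c: "fps_nth (B oo D) n = (\<Sum>i\<le>j. fps_nth B i * fps_nth (D ^ i) n)" if "n \<le> j" for n
    unfolding fps_compose_nth
    by (rule sum.mono_neutral_left) (use that assms startsby_zero_power_prefix[of D] in auto)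
  have "fps_nth ((B oo D) * H) j = (\<Sum>n=0..j. (\<Sum>i\<le>j. fps_nth B i * fps_nth (D ^ i) n) * fps_nth H (j - n))"
    unfolding fps_mult_nth by (intro sum.cong refl) (simp add: c)
  also have "\<dots> = (\<Sum>i\<le>j. \<Sum>n=0..j. fps_nth B i * fps_nth (D ^ i) n * fps_nth H (j - n))"
    unfolding sum_distrib_right by (rule sum.swap)
  finally show ?thesis by (simp add: fps_mult_nth sum_distrib_left mult.assoc)
qed

text \<open>Replacing \<open>x\<close> by \<open>x / (1 - t)\<close> moves \<open>x\<^sup>2\<close> by \<open>x\<^sup>2\<close> times this series in \<open>t\<close>.\<close>

abbreviation "inverse_square_shift \<equiv> (inverse ((1 - fps_X)\<^sup>2) - 1 :: real fps)"

lemma fps_binomial_compose_inverse_square_shift_nat: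
  "fps_binomial (- real c) oo inverse_square_shift = (1 - fps_X) ^ (2 * c)"
proof -
  have "fps_binomial (- real c) oo inverse_square_shift = inverse ((1 + fps_X) ^ c oo inverse_square_shift)"
    unfolding fps_binomial_minus_of_nat
    by (rule fps_inverse_compose) (auto simp: power2_eq_square)
  also have "(1 + fps_X) ^ c oo inverse_square_shift = ((1 + fps_X) oo inverse_square_shift) ^ c"
    by (rule fps_compose_power[symmetric]) (simp add: power2_eq_square)
  also have "(1 + fps_X) oo inverse_square_shift = inverse ((1 - fps_X)\<^sup>2)"
    by (simp add: fps_compose_add_distrib power2_eq_square)
  also have "inverse (inverse ((1 - fps_X :: real fps)\<^sup>2) ^ c) = (1 - fps_X) ^ (2 * c)"
    by (simp flip: fps_inverse_power add: power_mult)
  finally show ?thesis .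
qed

text \<open>This is \<open>((1 - t)\<^bsup>-2\<^esup>)\<^bsup>-c/2\<^esup> = (1 - t)\<^sup>c\<close>. Both sides have the same square, by
  the integral exponent case, and constant term \<open>1\<close>, so one is not the negative of the other.\<close>

lemma fps_binomial_compose_inverse_square_shift:
  "fps_binomial (- real c / 2) oo inverse_square_shift = (1 - fps_X) ^ c"
proof -
  define G where "G = fps_binomial (- real c / 2) oo inverse_square_shift"
  have "G * G = (fps_binomial (- real c / 2) * fps_binomial (- real c / 2)) oo inverse_square_shift"
    unfolding G_def by (rule fps_compose_mult_distrib[symmetric]) (simp add: power2_eq_square)
  also have "\<dots> = (1 - fps_X) ^ c * (1 - fps_X) ^ c"
    using fps_binomial_compose_inverse_square_shift_nat[of c]
    by (simp flip: fps_binomial_add_mult power_add add: mult_2)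
  finally have "(G - (1 - fps_X) ^ c) * (G + (1 - fps_X) ^ c) = 0"
    by (simp add: algebra_simps)
  moreover have "fps_nth (G + (1 - fps_X) ^ c) 0 \<noteq> 0" by (simp add: G_def fps_nth_power_0)
  then have "G + (1 - fps_X) ^ c \<noteq> 0" by (metis fps_zero_nth)
  ultimately show ?thesis by (simp add: G_def)
qed

lemma nth_inverse_one_minus_X_power:
  "fps_nth (inverse ((1 - fps_X :: real fps) ^ Suc n)) j = fact (n + j) / (fact n * fact j)"
  using arg_cong[OF one_minus_const_fps_X_neg_power'[of "Suc n" "1::real"], of "\<lambda>F. fps_nth F j"]
  by (simp add: binomial_fact)

lemma nth_inverse_one_plus_X_power:
  "fps_nth (inverse ((1 + fps_X :: real fps) ^ Suc n)) j = (-1) ^ j * fact (n + j) / (fact n * fact j)"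
proof -
  have "fps_nth (inverse ((1 - fps_const (-1) * fps_X :: real fps) ^ Suc n)) j
      = of_nat ((n + j) choose j) * (-1) ^ j"
    by (subst one_minus_const_fps_X_neg_power') auto
  then show ?thesis by (simp add: binomial_fact mult_ac flip: fps_const_neg)
qed

section \<open>The normalized Macdonald function of a squared argument\<close>

text \<open>The substitution \<open>w = (z/2) e\<^sup>s\<close> in the Schlaefli integral puts the normalized Macdonald
  function into the form \<open>1/2 \<integral> exp (- w - z\<^sup>2 / (4 w)) w\<^bsup>-\<beta>-1\<^esup> dw\<close> over \<open>(0,\<infinity>)\<close>. It depends on \<open>z\<close>
  through \<open>q = z\<^sup>2\<close> only, and on \<open>q\<close> through a single exponential.\<close>

definition macdonald_kernel :: "real \<Rightarrow> real \<Rightarrow> real \<Rightarrow> real" where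
  "macdonald_kernel \<beta> q w = indicator {0<..} w * (exp (- w - q / (4 * w)) * w powr (- \<beta> - 1))"

definition macdonald :: "real \<Rightarrow> real \<Rightarrow> real" where
  "macdonald \<beta> q = (LBINT w. macdonald_kernel \<beta> q w) / 2"

lemma macdonald_kernel_nonneg: "0 \<le> macdonald_kernel \<beta> q w"
  by (simp add: macdonald_kernel_def)

lemma measurable_macdonald_kernel [measurable]:
  "(\<lambda>x. macdonald_kernel \<beta> (f x) (g x)) \<in> borel_measurable M"
  if [measurable]: "f \<in> borel_measurable M" "g \<in> borel_measurable M"
  unfolding macdonald_kernel_def by measurable

text \<open>At \<open>q = 0\<close> the kernel is Euler's integrand.\<close>

lemma has_bochner_integral_macdonald_kernel_0:
  assumes "a > 0"
  shows "has_bochner_integral lborel (macdonald_kernel (- a) 0) (Gamma a)"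
proof -
  have "(\<integral>\<^sup>+w. ennreal (macdonald_kernel (- a) 0 w) \<partial>lborel) = ennreal (Gamma a)"
    unfolding Gamma_conv_nn_integral_real[OF assms]
    by (intro nn_integral_cong)
       (auto simp: macdonald_kernel_def indicator_def exp_minus field_simps)
  then show ?thesis
    using assms by (intro has_bochner_integral_nn_integral) (auto simp: macdonald_kernel_nonneg less_imp_le)
qed

text \<open>For \<open>q > 0\<close> the factor \<open>exp (- q / (4 w))\<close> decays faster at \<open>w = 0\<close> than any power, so it
  absorbs as many factors \<open>1 / w\<close> as are needed to reach a convergent Gamma integral.\<close>

lemma integrable_macdonald_kernel:
  assumes "q > 0"
  shows "integrable lborel (macdonald_kernel \<beta> q)"
proof -
  obtain N :: nat where N: "real N > \<beta>" "N > 0"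
    using reals_Archimedean2[of "max \<beta> 1"] by (metis max_less_iff_conj of_nat_0_less_iff zero_less_one less_trans)
  define C where "C = (4 * real N / q) ^ N"
  have "integrable lborel (\<lambda>w. C * macdonald_kernel (\<beta> - real N) 0 w)"
    using has_bochner_integral_macdonald_kernel_0[of "real N - \<beta>"] N
    by (auto simp: has_bochner_integral_iff)
  then show ?thesis
  proof (rule Bochner_Integration.integrable_bound)
    show "AE w in lborel. norm (macdonald_kernel \<beta> q w) \<le> norm (C * macdonald_kernel (\<beta> - real N) 0 w)"
    proof (rule AE_I2)
      fix w :: real
      show "norm (macdonald_kernel \<beta> q w) \<le> norm (C * macdonald_kernel (\<beta> - real N) 0 w)"
      proof (cases "w > 0")
        case True
        define y where "y = q / (4 * w)"
        have y: "y > 0" using True assms by (simp add: y_def)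
        \<comment> \<open>The bound \<open>exp (-y) \<le> (N / y)\<^sup>N\<close> follows from \<open>y / N \<le> exp (y / N)\<close>.\<close>
        have "(y / real N) ^ N \<le> exp (y / real N) ^ N"
        proof (rule power_mono)
          show "y / real N \<le> exp (y / real N)"
            using exp_ge_add_one_self[of "y / real N"] by linarith
        qed (use y in simp)
        also have "\<dots> = exp y" using N by (simp flip: exp_of_nat_mult)
        finally have "exp (- y) \<le> inverse ((y / real N) ^ N)"
          using y N unfolding exp_minus by (intro le_imp_inverse_le) auto
        also have "\<dots> = C * w ^ N"
          using True assms N by (simp add: y_def C_def field_simps power_mult_distrib power_divide)
        finally have "exp (- y) * (exp (- w) * w powr (- \<beta> - 1)) \<le> C * w ^ N * (exp (- w) * w powr (- \<beta> - 1))"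
          by (intro mult_right_mono) auto
        moreover have "w ^ N * w powr (- \<beta> - 1) = w powr (real N - \<beta> - 1)"
          using True by (simp add: powr_add[symmetric] flip: powr_realpow) (simp add: algebra_simps)
        moreover have "exp (- w - q / (4 * w)) = exp (- y) * exp (- w)"
          by (simp add: y_def flip: exp_add)
        then have "macdonald_kernel \<beta> q w = exp (- y) * (exp (- w) * w powr (- \<beta> - 1))"
          using True by (simp add: macdonald_kernel_def)
        moreover have "macdonald_kernel (\<beta> - real N) 0 w = exp (- w) * w powr (real N - \<beta> - 1)"
          using True by (simp add: macdonald_kernel_def)
        ultimately have "macdonald_kernel \<beta> q w \<le> C * macdonald_kernel (\<beta> - real N) 0 w"
          by (simp only: mult.assoc mult.left_commute[of "w ^ N"])
        then show ?thesis using macdonald_kernel_nonneg[of \<beta> q w] by simp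
      qed (simp add: macdonald_kernel_def)
    qed
  qed simp
qed

text \<open>Expanding \<open>exp (- h / (4 w))\<close> under the integral multiplies the kernel by powers of \<open>1 / w\<close>, that is,
  raises the order. The series of absolute values is the kernel at \<open>q - |h|\<close>, which is integrable for
  \<open>|h| < q\<close> and so justifies integrating termwise.\<close>

lemma macdonald_sums:
  assumes "\<bar>h\<bar> < q"
  shows "(\<lambda>i. (- 1 / 4) ^ i / fact i * macdonald (\<beta> + real i) q * h ^ i) sums macdonald \<beta> (q + h)"
proof -
  define c where "c = (\<lambda>i. (- h / 4) ^ i / fact i)"
  define f where "f = (\<lambda>i w. c i * macdonald_kernel (\<beta> + real i) q w)"
  have q: "q > 0" using assms by linarith
  have f_eq: "f i w = macdonald_kernel \<beta> q w * ((- h / (4 * w)) ^ i / fact i)" for i w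
    by (auto simp: f_def c_def macdonald_kernel_def indicator_def powr_diff powr_add powr_minus powr_realpow
                   power_divide power_minus[of "h / _"] power_minus[of h] divide_simps power_mult_distrib)
  have E: "macdonald_kernel \<beta> q w * exp (- k / (4 * w)) = macdonald_kernel \<beta> (q + k) w" for k w
    by (auto simp: macdonald_kernel_def indicator_def add_divide_distrib mult_ac simp flip: exp_add)
  have ex: "(\<lambda>i. y ^ i / fact i) sums exp y" for y :: real
    using exp_converges[of y] by (simp add: divide_inverse mult.commute)
  have s: "(\<lambda>i. f i w) sums macdonald_kernel \<beta> (q + h) w" for w
    unfolding f_eq E[symmetric] by (intro sums_mult ex)
  have sabs: "(\<lambda>i. norm (f i w)) sums macdonald_kernel \<beta> (q - \<bar>h\<bar>) w" for w
  proof -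
    have "(\<lambda>i. macdonald_kernel \<beta> q w * ((\<bar>h\<bar> / (4 * w)) ^ i / fact i)) sums macdonald_kernel \<beta> (q + (- \<bar>h\<bar>)) w"
      unfolding E[symmetric] by (intro sums_mult) (use ex[of "\<bar>h\<bar> / (4 * w)"] in simp)
    moreover have "norm (f i w) = macdonald_kernel \<beta> q w * ((\<bar>h\<bar> / (4 * w)) ^ i / fact i)" for i
      by (cases "w > 0") (auto simp: f_eq abs_mult macdonald_kernel_nonneg power_abs macdonald_kernel_def)
    ultimately show ?thesis by simp
  qed
  have int: "integrable lborel (f i)" for i
    unfolding f_def by (intro integrable_mult_right integrable_macdonald_kernel q)
  have "(\<lambda>i. integral\<^sup>L lborel (f i)) sums (LBINT w. (\<Sum>i. f i w))"
  proof (rule sums_integral[OF int])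
    show "AE w in lborel. summable (\<lambda>i. norm (f i w))"
      using sabs by (auto simp: sums_iff)
    show "summable (\<lambda>i. LBINT w. norm (f i w))"
    proof (rule summableI_nonneg_bounded)
      fix n
      have "(\<Sum>i<n. LBINT w. norm (f i w)) = (LBINT w. (\<Sum>i<n. norm (f i w)))"
        using int by (intro Bochner_Integration.integral_sum[symmetric]) auto
      also have "\<dots> \<le> (LBINT w. macdonald_kernel \<beta> (q - \<bar>h\<bar>) w)"
      proof (rule integral_mono)
        show "integrable lborel (\<lambda>w. \<Sum>i<n. norm (f i w))" using int by auto
        show "integrable lborel (macdonald_kernel \<beta> (q - \<bar>h\<bar>))"
          by (rule integrable_macdonald_kernel) (use assms in simp)
        show "(\<Sum>i<n. norm (f i w)) \<le> macdonald_kernel \<beta> (q - \<bar>h\<bar>) w" for w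
          using sum_le_suminf[OF sums_summable[OF sabs[of w]], of "{..<n}"] sums_unique[OF sabs[of w]] by simp
      qed
      finally show "(\<Sum>i<n. LBINT w. norm (f i w)) \<le> (LBINT w. macdonald_kernel \<beta> (q - \<bar>h\<bar>) w)" .
    qed simp
  qed
  also have "(\<lambda>w. \<Sum>i. f i w) = macdonald_kernel \<beta> (q + h)"
    using s by (auto simp: sums_iff)
  finally have "(\<lambda>i. integral\<^sup>L lborel (f i) / 2) sums macdonald \<beta> (q + h)"
    unfolding macdonald_def by (rule sums_divide)
  moreover have "integral\<^sup>L lborel (f i) / 2 = (- 1 / 4) ^ i / fact i * macdonald (\<beta> + real i) q * h ^ i" for i
    by (simp add: f_def c_def macdonald_def flip: power_mult_distrib)
  ultimately show ?thesis by simp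
qed

lemma has_fps_expansion_macdonald:
  assumes "q > 0"
  shows "(\<lambda>h. macdonald \<beta> (q + h)) has_fps_expansion
           Abs_fps (\<lambda>i. (- 1 / 4) ^ i / fact i * macdonald (\<beta> + real i) q)"
proof (rule has_fps_expansionI)
  have "eventually (\<lambda>h. h \<in> ball 0 q) (nhds 0)"
    using assms by (intro eventually_nhds_in_open) auto
  then show "eventually (\<lambda>h. (\<lambda>i. fps_nth (Abs_fps (\<lambda>i. (- 1 / 4) ^ i / fact i * macdonald (\<beta> + real i) q)) i * h ^ i)
               sums macdonald \<beta> (q + h)) (nhds 0)"
    by eventually_elim (use macdonald_sums[of _ q \<beta>] in \<open>simp add: dist_real_def\<close>)
qed

lemma DERIV_macdonald:
  assumes "q > 0"
  shows "(macdonald \<beta> has_real_derivative (- macdonald (\<beta> + 1) q / 4)) (at q)"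
proof -
  define F where "F = Abs_fps (\<lambda>i. (- 1 / 4) ^ i / fact i * macdonald (\<beta> + real i) q)"
  have F: "fps_conv_radius F > 0" "eventually (\<lambda>h. eval_fps F h = macdonald \<beta> (q + h)) (nhds 0)"
    using has_fps_expansion_macdonald[OF assms, of \<beta>] by (auto simp: F_def has_fps_expansion_def)
  have "(eval_fps F has_real_derivative eval_fps (fps_deriv F) 0) (at 0)"
    using F(1) by (intro has_field_derivative_eval_fps) (simp add: zero_ereal_def)
  then have "((\<lambda>h. macdonald \<beta> (q + h)) has_real_derivative eval_fps (fps_deriv F) 0) (at 0)"
    using F(2) by (subst (asm) DERIV_cong_ev[OF refl _ refl]) auto
  then have "(macdonald \<beta> has_real_derivative eval_fps (fps_deriv F) 0) (at q)"
    using DERIV_shift[of "macdonald \<beta>" _ 0 q] by (simp add: add.commute)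
  then show ?thesis by (simp add: eval_fps_at_0 F_def)
qed

lemma integral_even_split:
  fixes f :: "real \<Rightarrow> real"
  assumes f: "integrable lborel f"
  shows "(LBINT t. f t) = (LBINT t:{0..}. f t + f (- t))"
proof -
  have fm: "integrable lborel (\<lambda>t. f (- t))"
    using lborel_integrable_real_affine[OF f, of "-1" 0] by simp
  have "(LBINT t. f t) = (LBINT t. indicator {0..} t * f t + indicator {..<0} t * f t)"
    by (intro Bochner_Integration.integral_cong) (auto simp: indicator_def)
  also have "\<dots> = (LBINT t. indicator {0..} t * f t) + (LBINT t. indicator {..<0} t * f t)"
    using f by (intro Bochner_Integration.integral_add integrable_mult_indicator[where 'b = real, simplified]) auto
  also have "(LBINT t. indicator {..<0} t * f t) = (LBINT t. indicator {..<0} (- t) * f (- t))"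
    using lborel_integral_real_affine[of "-1" "\<lambda>t. indicator {..<0} t * f t" 0] by simp
  also have "\<dots> = (LBINT t. indicator {0..} t * f (- t))"
  proof (rule integral_cong_AE)
    have [measurable]: "(\<lambda>t. f (- t)) \<in> borel_measurable borel"
      using fm by (simp add: integrable_iff_bounded)
    show "(\<lambda>t. indicator {..<0} (- t) * f (- t)) \<in> borel_measurable lborel"
         "(\<lambda>t. indicator {0..} t * f (- t)) \<in> borel_measurable lborel"
      by measurable
    show "AE t in lborel. indicator {..<0} (- t) * f (- t) = indicator {0..} t * f (- t)"
      using AE_lborel_singleton[of 0] by eventually_elim (simp add: indicator_def)
  qed
  also have "(LBINT t. indicator {0..} t * f t) + (LBINT t. indicator {0..} t * f (- t))
      = (LBINT t. indicator {0..} t * f t + indicator {0..} t * f (- t))"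
    using f fm by (intro Bochner_Integration.integral_add[symmetric] integrable_mult_indicator[where 'b = real, simplified]) auto
  finally show ?thesis by (simp add: set_lebesgue_integral_def algebra_simps)
qed

lemma K_norm_eq_macdonald:
  assumes z: "z > 0"
  shows "K_norm \<beta> z = macdonald \<beta> (z\<^sup>2)"
proof -
  define f where "f = (\<lambda>s. exp (- z * cosh s) * exp (- \<beta> * s))"
  \<comment> \<open>The change of variables runs from \<open>w\<close> to \<open>s\<close>, since integrability is known on the \<open>w\<close> side.\<close>
  define g where "g = (\<lambda>w. ln (2 / z) + ln w)"
  have fg: "f (g w) * (1 / w) = (z / 2) powr \<beta> * macdonald_kernel \<beta> (z\<^sup>2) w" if w: "w > 0" for w
  proof -
    have "g w = ln (2 * w / z)"
      using w z by (simp add: g_def ln_mult ln_div)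
    then have zc: "z * cosh (g w) = w + z\<^sup>2 / (4 * w)"
      using w z by (simp add: cosh_ln_real field_simps power2_eq_square)
    have e: "exp (- \<beta> * g w) = (z / 2) powr \<beta> * w powr (- \<beta>)"
      using w z by (simp add: g_def powr_def ln_mult ln_div algebra_simps flip: exp_add)
    have "- z * cosh (g w) = - w - z\<^sup>2 / (4 * w)" using zc by simp
    then have "f (g w) = exp (- w - z\<^sup>2 / (4 * w)) * ((z / 2) powr \<beta> * w powr (- \<beta>))"
      unfolding f_def e by simp
    moreover have "w powr (- \<beta> - 1) = w powr (- \<beta>) / w"
      using w by (simp add: powr_diff)
    ultimately show ?thesis
      using w by (simp add: macdonald_kernel_def)
  qed
  have fgint: "(\<lambda>w. indicator (einterval 0 \<infinity>) w *\<^sub>R (f (g w) * (1 / w)))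
      = (\<lambda>w. (z / 2) powr \<beta> * macdonald_kernel \<beta> (z\<^sup>2) w)"
    using fg by (auto simp: fun_eq_iff einterval_def indicator_def macdonald_kernel_def)
  have sub: "set_integrable lborel (einterval (-\<infinity>) \<infinity>) f"
            "(LBINT x=-\<infinity>..\<infinity>. f x) = (LBINT x=0..\<infinity>. f (g x) * (1 / x))"
  proof -
    have lim0: "((ereal \<circ> g \<circ> real_of_ereal) \<longlongrightarrow> - \<infinity>) (at_right 0)"
      unfolding zero_ereal_def ereal_tendsto_simps g_def
      by (rule filterlim_tendsto_add_at_bot_iff[OF tendsto_const, THEN iffD2, OF ln_at_0])
    have lim1: "((ereal \<circ> g \<circ> real_of_ereal) \<longlongrightarrow> \<infinity>) (at_left \<infinity>)"
      unfolding ereal_tendsto_simps g_def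
      by (rule filterlim_tendsto_add_at_top[OF tendsto_const ln_at_top])
    have int: "set_integrable lborel (einterval 0 \<infinity>) (\<lambda>w. f (g w) * (1 / w))"
    proof -
      have "integrable lborel (\<lambda>w. (z / 2) powr \<beta> * macdonald_kernel \<beta> (z\<^sup>2) w)"
        using z by (intro integrable_mult_right integrable_macdonald_kernel) auto
      then show ?thesis unfolding set_integrable_def fgint .
    qed
    note * = interval_integral_substitution_nonneg[of 0 \<infinity> g "\<lambda>w. 1 / w" f "-\<infinity>" \<infinity>, OF _ _ _ _ _ _ lim0 lim1 int]
    show "set_integrable lborel (einterval (-\<infinity>) \<infinity>) f"
      by (rule *) (use z in \<open>auto simp: g_def f_def intro!: derivative_eq_intros continuous_intros\<close>)
    show "(LBINT x=-\<infinity>..\<infinity>. f x) = (LBINT x=0..\<infinity>. f (g x) * (1 / x))"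
      by (rule *) (use z in \<open>auto simp: g_def f_def intro!: derivative_eq_intros continuous_intros\<close>)
  qed
  have intf: "integrable lborel f"
    using sub(1) by (simp add: set_integrable_def einterval_def)
  have "2 * bessel_K \<beta> z = (LBINT t:{0..}. f t + f (- t))"
    unfolding bessel_K_def set_integral_mult_right[symmetric]
    by (intro set_lebesgue_integral_cong) (auto simp: f_def cosh_def field_simps)
  also have "\<dots> = (LBINT t. f t)" using integral_even_split[OF intf] by simp
  also have "\<dots> = (LBINT x=-\<infinity>..\<infinity>. f x)"
    by (simp add: interval_lebesgue_integral_def einterval_def set_lebesgue_integral_def)
  also have "\<dots> = (LBINT x=0..\<infinity>. f (g x) * (1 / x))" by (rule sub(2))
  also have "\<dots> = (LBINT w. (z / 2) powr \<beta> * macdonald_kernel \<beta> (z\<^sup>2) w)"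
    unfolding interval_lebesgue_integral_def set_lebesgue_integral_def fgint by simp
  also have "\<dots> = 2 * ((z / 2) powr \<beta> * macdonald \<beta> (z\<^sup>2))"
    by (simp add: macdonald_def)
  finally show ?thesis using z by (simp add: K_norm_def powr_minus field_simps)
qed

text \<open>The Schlaefli integral is even in the order. Thus the singularity at \<open>q = 0\<close> for positive order is an explicit
  power times a function of negative order, which is continuous up to \<open>0\<close>.\<close>

lemma macdonald_reflect:
  assumes "q > 0"
  shows "macdonald \<beta> q = (q / 4) powr (- \<beta>) * macdonald (- \<beta>) q"
proof -
  define z where "z = sqrt q"
  have z: "z > 0" "q = z\<^sup>2" using assms by (auto simp: z_def)
  have "q / 4 = (z / 2) * (z / 2)" using z by (simp add: power2_eq_square)
  then have "(q / 4) powr (- \<beta>) = (z / 2) powr (- \<beta>) * (z / 2) powr (- \<beta>)"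
    using z by (simp only: powr_mult)
  moreover have "bessel_K (- \<beta>) z = bessel_K \<beta> z" by (simp add: bessel_K_def)
  ultimately show ?thesis
    using z by (simp add: K_norm_def flip: K_norm_eq_macdonald powr_add)
qed

text \<open>For negative order the kernels increase, as \<open>q\<close> decreases to \<open>0\<close>, to the integrable kernel at \<open>0\<close>,
  which dominates them.\<close>

lemma tendsto_macdonald_0:
  assumes "\<beta> > 0"
  shows "(macdonald (- \<beta>) \<longlongrightarrow> Gamma \<beta> / 2) (at_right 0)"
  unfolding tendsto_at_iff_sequentially o_def
proof safe
  fix X :: "nat \<Rightarrow> real"
  assume X: "\<forall>i. X i \<in> {0<..} - {0}" "X \<longlonglongrightarrow> 0"
  have "(\<lambda>i. LBINT w. macdonald_kernel (- \<beta>) (X i) w) \<longlonglongrightarrow> (LBINT w. macdonald_kernel (- \<beta>) 0 w)"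
  proof (rule integral_dominated_convergence[where w = "macdonald_kernel (- \<beta>) 0"])
    show "integrable lborel (macdonald_kernel (- \<beta>) 0)"
      using has_bochner_integral_macdonald_kernel_0[OF assms] by (simp add: has_bochner_integral_iff)
    show "AE w in lborel. (\<lambda>i. macdonald_kernel (- \<beta>) (X i) w) \<longlonglongrightarrow> macdonald_kernel (- \<beta>) 0 w"
    proof (rule AE_I2)
      fix w :: real
      have "(\<lambda>i. - w - X i / (4 * w)) \<longlonglongrightarrow> - w - 0 / (4 * w)" if "w > 0"
        using that X(2) by (intro tendsto_intros) auto
      then show "(\<lambda>i. macdonald_kernel (- \<beta>) (X i) w) \<longlonglongrightarrow> macdonald_kernel (- \<beta>) 0 w"
        by (cases "w > 0") (auto simp: macdonald_kernel_def intro!: tendsto_intros)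
    qed
    show "AE w in lborel. norm (macdonald_kernel (- \<beta>) (X i) w) \<le> macdonald_kernel (- \<beta>) 0 w" for i
      using X(1) by (intro AE_I2)
        (auto simp: macdonald_kernel_def indicator_def less_imp_le intro!: mult_right_mono divide_nonneg_pos)
  qed auto
  then show "(\<lambda>i. macdonald (- \<beta>) (X i)) \<longlonglongrightarrow> Gamma \<beta> / 2"
    using has_bochner_integral_macdonald_kernel_0[OF assms]
    by (auto simp: macdonald_def has_bochner_integral_iff intro!: tendsto_divide)
qed

lemma has_bochner_integral_gaussian_odd:
  assumes "c > (0::real)"
  shows "has_bochner_integral lborel (\<lambda>x. indicator {0<..} x * (x ^ (2 * n + 1) * exp (- (x\<^sup>2 * c))))
           (fact n / (2 * c ^ (n + 1)))"
proof -
  define f where "f = (\<lambda>x::real. indicator {0..} x *\<^sub>R (exp (- x\<^sup>2) * x ^ (2 * n + 1)))"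
  have "has_bochner_integral lborel (\<lambda>x. f (0 + sqrt c * x)) ((fact n / 2) /\<^sub>R \<bar>sqrt c\<bar>)"
    using gaussian_moment_odd_pos[of n] assms unfolding f_def[symmetric]
    by (subst (asm) lborel_has_bochner_integral_real_affine_iff[of "sqrt c" _ _ 0]) auto
  then have "has_bochner_integral lborel (\<lambda>x. f (sqrt c * x) * inverse (sqrt c ^ (2 * n + 1)))
     (((fact n / 2) /\<^sub>R \<bar>sqrt c\<bar>) * inverse (sqrt c ^ (2 * n + 1)))"
    by (intro has_bochner_integral_mult_left) simp
  moreover have "f (sqrt c * x) * inverse (sqrt c ^ (2 * n + 1)) =
      indicator {0<..} x * (x ^ (2 * n + 1) * exp (- (x\<^sup>2 * c)))" for x
    using assms by (auto simp: f_def indicator_def power_mult_distrib zero_le_mult_iff mult_ac)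
  moreover have "((fact n / 2) /\<^sub>R \<bar>sqrt c\<bar>) * inverse (sqrt c ^ (2 * n + 1)) = fact n / (2 * c ^ (n + 1))"
  proof -
    have "sqrt c * sqrt c ^ (2 * n + 1) = (sqrt c)\<^sup>2 ^ (n + 1)"
      unfolding power_mult[symmetric] power_Suc[symmetric] by simp
    then have "sqrt c * sqrt c ^ (2 * n + 1) = c ^ (n + 1)" using assms by simp
    moreover have "((F / 2) /\<^sub>R \<bar>s\<bar>) * inverse p = F / (2 * r)" if "s > 0" "s * p = r" for F s p r :: real
      unfolding that(2)[symmetric] abs_of_pos[OF that(1)] real_scaleR_def divide_inverse inverse_mult_distrib
      by (simp only: mult_ac)
    ultimately show ?thesis using real_sqrt_gt_zero[OF assms] by blast
  qed
  ultimately show ?thesis by (simp only:)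
qed

text \<open>The Mellin transform of \<open>K\<close> at the odd powers. By Tonelli's theorem the integral over \<open>x\<close> may be taken
  first; it is a Gaussian moment and leaves a Gamma integral in \<open>w\<close>.\<close>

lemma has_bochner_integral_macdonald_power:
  assumes "\<beta> < real n + 1"
  shows "has_bochner_integral lborel (\<lambda>x. indicator {0<..} x * (x ^ (2 * n + 1) * macdonald \<beta> (x\<^sup>2)))
           (4 ^ n * fact n * Gamma (real n + 1 - \<beta>))"
proof -
  define F where "F = (\<lambda>x w. indicator {0<..} x * (x ^ (2 * n + 1) * macdonald_kernel \<beta> (x\<^sup>2) w))"
  define b where "b = real n + 1 - \<beta>"
  have Fm[measurable]: "(\<lambda>(x, w). F x w) \<in> borel_measurable (lborel \<Otimes>\<^sub>M lborel)"
    unfolding F_def by measurable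
  have Fnn: "0 \<le> F x w" for x w
    by (auto simp: F_def indicator_def macdonald_kernel_nonneg)
  have inner: "(\<integral>\<^sup>+x. ennreal (F x w) \<partial>lborel) = ennreal (2 * 4 ^ n * fact n * macdonald_kernel (- b) 0 w)" for w
  proof (cases "w > 0")
    case True
    have "F x w = macdonald_kernel \<beta> 0 w * (indicator {0<..} x * (x ^ (2 * n + 1) * exp (- (x\<^sup>2 * (1 / (4 * w))))))" for x
      using True by (simp add: F_def macdonald_kernel_def exp_diff exp_minus field_simps)
    moreover have "has_bochner_integral lborel (\<lambda>x. macdonald_kernel \<beta> 0 w * (indicator {0<..} x * (x ^ (2 * n + 1) * exp (- (x\<^sup>2 * (1 / (4 * w)))))))
       (macdonald_kernel \<beta> 0 w * (fact n / (2 * (1 / (4 * w)) ^ (n + 1))))"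
      using True by (intro has_bochner_integral_mult_right has_bochner_integral_gaussian_odd) auto
    moreover have "macdonald_kernel \<beta> 0 w * (fact n / (2 * (1 / (4 * w)) ^ (n + 1))) = 2 * 4 ^ n * fact n * macdonald_kernel (- b) 0 w"
    proof -
      have "w ^ (n + 1) * w powr (- \<beta> - 1) = w powr (real (n + 1) + (- \<beta> - 1))"
        using True by (simp only: powr_add powr_realpow)
      also have "real (n + 1) + (- \<beta> - 1) = b - 1" by (simp add: b_def)
      finally have "w ^ (n + 1) * w powr (- \<beta> - 1) = w powr (b - 1)" .
      then show ?thesis using True
        by (simp add: macdonald_kernel_def power_divide power_mult_distrib field_simps)
    qed
    ultimately have "has_bochner_integral lborel (\<lambda>x. F x w) (2 * 4 ^ n * fact n * macdonald_kernel (- b) 0 w)"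
      by simp
    then show ?thesis
      using Fnn by (subst nn_integral_eq_integral) (auto simp: has_bochner_integral_iff)
  qed (simp add: F_def macdonald_kernel_def)
  have outer: "(\<integral>\<^sup>+w. ennreal (2 * 4 ^ n * fact n * macdonald_kernel (- b) 0 w) \<partial>lborel)
      = ennreal (2 * 4 ^ n * fact n * Gamma b)"
  proof -
    have "has_bochner_integral lborel (\<lambda>w. 2 * 4 ^ n * fact n * macdonald_kernel (- b) 0 w) (2 * 4 ^ n * fact n * Gamma b)"
      using assms by (intro has_bochner_integral_mult_right has_bochner_integral_macdonald_kernel_0) (auto simp: b_def)
    then show ?thesis
      by (subst nn_integral_eq_integral) (auto simp: has_bochner_integral_iff macdonald_kernel_nonneg)
  qed
  have G: "ennreal (indicator {0<..} x * (x ^ (2 * n + 1) * (2 * macdonald \<beta> (x\<^sup>2)))) = (\<integral>\<^sup>+w. ennreal (F x w) \<partial>lborel)" for x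
  proof (cases "x > 0")
    case True
    have "integrable lborel (F x)"
      unfolding F_def using True by (intro integrable_mult_right integrable_macdonald_kernel) auto
    then have "(\<integral>\<^sup>+w. ennreal (F x w) \<partial>lborel) = ennreal (LBINT w. F x w)"
      using Fnn by (intro nn_integral_eq_integral) auto
    also have "(LBINT w. F x w) = indicator {0<..} x * (x ^ (2 * n + 1) * (2 * macdonald \<beta> (x\<^sup>2)))"
      by (simp add: F_def macdonald_def)
    finally show ?thesis by simp
  qed (simp add: F_def)
  have "(\<integral>\<^sup>+x. ennreal (indicator {0<..} x * (x ^ (2 * n + 1) * (2 * macdonald \<beta> (x\<^sup>2)))) \<partial>lborel)
      = (\<integral>\<^sup>+x. \<integral>\<^sup>+w. ennreal (F x w) \<partial>lborel \<partial>lborel)"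
    by (simp only: G)
  also have "\<dots> = (\<integral>\<^sup>+w. \<integral>\<^sup>+x. ennreal (F x w) \<partial>lborel \<partial>lborel)"
    by (rule lborel_pair.Fubini') measurable
  also have "\<dots> = ennreal (2 * 4 ^ n * fact n * Gamma b)"
    by (simp only: inner outer)
  finally have "has_bochner_integral lborel (\<lambda>x. indicator {0<..} x * (x ^ (2 * n + 1) * (2 * macdonald \<beta> (x\<^sup>2))))
      (2 * 4 ^ n * fact n * Gamma b)"
    using assms
    by (intro has_bochner_integral_nn_integral)
       (auto simp: b_def indicator_def macdonald_def macdonald_kernel_nonneg intro!: Bochner_Integration.integral_nonneg)
  then have "has_bochner_integral lborel (\<lambda>x. 1 / 2 * (indicator {0<..} x * (x ^ (2 * n + 1) * (2 * macdonald \<beta> (x\<^sup>2)))))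
      (1 / 2 * (2 * 4 ^ n * fact n * Gamma b))"
    by (rule has_bochner_integral_mult_right)
  also have "1 / 2 * (2 * 4 ^ n * fact n * Gamma b) = 4 ^ n * fact n * Gamma (real n + 1 - \<beta>)"
    by (simp add: b_def)
  also have "(\<lambda>x. 1 / 2 * (indicator {0<..} x * (x ^ (2 * n + 1) * (2 * macdonald \<beta> (x\<^sup>2))))) =
      (\<lambda>x. indicator {0<..} x * (x ^ (2 * n + 1) * macdonald \<beta> (x\<^sup>2)))"
    by (simp add: fun_eq_iff)
  finally show ?thesis .
qed

section \<open>The coefficient functions as finite sums\<close>

definition I_norm_fps :: "real \<Rightarrow> real fps" where
  "I_norm_fps \<alpha> = Abs_fps (\<lambda>p. if even p then rGamma (real (p div 2) + \<alpha> + 1) / (fact (p div 2) * 4 ^ (p div 2)) else 0)"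

lemma I_norm_sums:
  assumes "\<alpha> > -1"
  shows "(\<lambda>p. fps_nth (I_norm_fps \<alpha>) p * z ^ p) sums I_norm \<alpha> z"
proof -
  define f where "f = (\<lambda>k. rGamma (real k + \<alpha> + 1) / fact k * (z / 2) ^ (2 * k))"
  obtain N :: nat where N: "real N > z\<^sup>2 / (2 * (\<alpha> + 1))"
    using reals_Archimedean2 by blast
  have "summable f"
  proof (rule summable_ratio_test[of "1 / 2" N])
    fix k assume k: "k \<ge> N"
    define r where "r = rGamma (real (Suc k) + \<alpha> + 1)"
    have a: "real k + \<alpha> + 1 > 0" using assms by simp
    have rec: "rGamma (real k + \<alpha> + 1) = (real k + \<alpha> + 1) * r"
      using rGamma_plus1[of "real k + \<alpha> + 1"] by (simp add: r_def add_ac)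
    have "z\<^sup>2 / (2 * (\<alpha> + 1)) \<le> real (Suc k)" using N k by simp
    then have "z\<^sup>2 \<le> 2 * (\<alpha> + 1) * real (Suc k)"
      using assms by (simp add: pos_divide_le_eq mult.commute)
    also have "\<dots> \<le> 2 * (real k + \<alpha> + 1) * real (Suc k)"
      using assms by (intro mult_right_mono mult_left_mono) auto
    finally have zz: "z\<^sup>2 \<le> 2 * (real k + \<alpha> + 1) * real (Suc k)" .
    have fS: "f (Suc k) = (r / fact (Suc k) * (z / 2) ^ (2 * k)) * (z\<^sup>2 / 4)"
      by (simp add: f_def r_def power2_eq_square mult_ac)
    have fk: "f k = (r / fact (Suc k) * (z / 2) ^ (2 * k)) * ((real k + \<alpha> + 1) * real (Suc k))"
    proof -
      have "(a * r) / F * Z = (r / (S * F) * Z) * (a * S)" if "S \<noteq> 0" for a F Z S :: real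
        using that by (simp add: divide_inverse mult_ac)
      from this[of "real (Suc k)"] show ?thesis
        unfolding f_def rec fact_Suc by simp
    qed
    define A where "A = (real k + \<alpha> + 1) * real (Suc k)"
    define Q where "Q = r / fact (Suc k) * (z / 2) ^ (2 * k)"
    have "A \<ge> 0" unfolding A_def using a by (intro mult_nonneg_nonneg) auto
    have "z\<^sup>2 \<le> 2 * A" using zz by (simp only: A_def mult.assoc)
    then have "\<bar>Q\<bar> * (z\<^sup>2 / 4) \<le> \<bar>Q\<bar> * (1 / 2 * A)" by (intro mult_left_mono) auto
    then show "norm (f (Suc k)) \<le> 1 / 2 * norm (f k)"
      unfolding fS fk A_def[symmetric] Q_def[symmetric] using \<open>A \<ge> 0\<close>
      by (simp add: abs_mult)
  qed simp
  then have "f sums I_norm \<alpha> z" by (simp add: I_norm_def f_def summable_sums)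
  also have "f = (\<lambda>k. fps_nth (I_norm_fps \<alpha>) (2 * k) * z ^ (2 * k))"
    by (simp add: f_def I_norm_fps_def fun_eq_iff power_divide power_mult)
  finally have "(\<lambda>k. fps_nth (I_norm_fps \<alpha>) (2 * k) * z ^ (2 * k)) sums I_norm \<alpha> z" .
  moreover have "fps_nth (I_norm_fps \<alpha>) p * z ^ p = 0" if "p \<notin> range (\<lambda>k. 2 * k)" for p
  proof -
    have "odd p" using that by (metis evenE rangeI)
    then show ?thesis by (simp add: I_norm_fps_def)
  qed
  ultimately show ?thesis
    using sums_mono_reindex[of "\<lambda>k. 2 * k" "\<lambda>p. fps_nth (I_norm_fps \<alpha>) p * z ^ p" "I_norm \<alpha> z"]
    by (simp add: strict_mono_def)
qed

lemma has_fps_expansion_I_norm: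
  "\<alpha> > -1 \<Longrightarrow> I_norm \<alpha> has_fps_expansion I_norm_fps \<alpha>"
  by (rule has_fps_expansionI) (simp add: I_norm_sums)

text \<open>The coefficient of \<open>t\<^sup>j\<close> in \<open>(t / (1-t))\<^sup>p ((1-t)\<^bsup>-2\<^esup> - 1)\<^sup>i (1-t)\<^bsup>-m-1\<^esup>\<close>: what the generating
  function leaves of \<open>t\<close> once the \<open>p\<close>-th term of \<open>I\<close> and the \<open>i\<close>-th Taylor term of \<open>K\<close> are split off.\<close>

definition Lambda_weight :: "nat \<Rightarrow> nat \<Rightarrow> nat \<Rightarrow> nat \<Rightarrow> real" where
  "Lambda_weight m j p i =
     fps_nth ((fps_X * inverse (1 - fps_X)) ^ p * (inverse_square_shift ^ i * inverse ((1 - fps_X) ^ Suc m))) j"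

lemma has_fps_expansion_one_minus_X:
  "(\<lambda>t. 1 - t) has_fps_expansion (1 - fps_X :: real fps)"
  by (intro has_fps_expansion_diff has_fps_expansion_1 has_fps_expansion_fps_X)

lemma has_fps_expansion_one_minus_X_power:
  "(\<lambda>t. (1 - t) ^ n) has_fps_expansion ((1 - fps_X :: real fps) ^ n)"
  by (induction n) (auto intro!: has_fps_expansion_mult has_fps_expansion_one_minus_X)

lemma has_fps_expansion_inverse_one_minus_X_power:
  "(\<lambda>t. inverse ((1 - t) ^ n)) has_fps_expansion (inverse ((1 - fps_X :: real fps) ^ n))"
  by (intro has_fps_expansion_inverse has_fps_expansion_one_minus_X_power) (simp add: fps_nth_power_0)

lemma has_fps_expansion_Lambda_gen:
  fixes \<mu> \<nu> :: int
  assumes x: "x > 0" and \<mu>: "\<mu> \<ge> -1" and m: "\<mu> + \<nu> = 2 * int m"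
  defines "\<alpha> \<equiv> real_of_int \<nu> / 2"
  shows "Lambda_gen \<mu> \<nu> x has_fps_expansion
     (I_norm_fps (of_int \<mu> / 2) oo (fps_const x * (fps_X * inverse (1 - fps_X)))) *
     ((Abs_fps (\<lambda>i. (- 1 / 4) ^ i / fact i * macdonald (\<alpha> + real i) (x\<^sup>2)) oo (fps_const (x\<^sup>2) * inverse_square_shift)) *
      inverse ((1 - fps_X) ^ Suc m))" (is "_ has_fps_expansion ?F")
proof -
  define g where "g = (\<lambda>t. I_norm (of_int \<mu> / 2) (x * (t * inverse ((1 - t) ^ 1))) *
     (macdonald \<alpha> (x\<^sup>2 + x\<^sup>2 * (inverse ((1 - t)\<^sup>2) - 1)) * inverse ((1 - t) ^ Suc m)))"
  have one: "inverse ((1 - fps_X :: real fps) ^ 1) = inverse (1 - fps_X)" by simp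
  have "g has_fps_expansion ?F"
    unfolding g_def one[symmetric]
    by (intro has_fps_expansion_mult has_fps_expansion_inverse_one_minus_X_power
          has_fps_expansion_compose[where f = "I_norm _"] has_fps_expansion_I_norm
          has_fps_expansion_compose[where f = "\<lambda>h. macdonald \<alpha> (x\<^sup>2 + h)"] has_fps_expansion_macdonald
          has_fps_expansion_const has_fps_expansion_diff has_fps_expansion_1 has_fps_expansion_fps_X)
       (use x \<mu> in \<open>auto simp: power2_eq_square\<close>)
  moreover have "eventually (\<lambda>t. g t = Lambda_gen \<mu> \<nu> x t) (nhds 0)"
  proof -
    have "eventually (\<lambda>t. t < (1::real)) (nhds 0)"
      by (rule eventually_nhds_in_open[of "{..<1}", simplified]) auto
    then show ?thesis
    proof eventually_elim
      case (elim t)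
      have "real_of_int (\<mu> + \<nu> + 2) / 2 = real (Suc m)" using m by simp
      then have "(1 - t) powr (of_int (\<mu> + \<nu> + 2) / 2) = (1 - t) ^ Suc m"
        using elim by (simp only: powr_realpow)
      moreover have "K_norm \<alpha> (x / (1 - t)) = macdonald \<alpha> (x\<^sup>2 + x\<^sup>2 * (inverse ((1 - t)\<^sup>2) - 1))"
        using elim x by (simp add: K_norm_eq_macdonald power_divide power_inverse algebra_simps divide_inverse)
      moreover have "x * (t * inverse ((1 - t) ^ 1)) = t * x / (1 - t)"
        by (simp add: divide_inverse)
      moreover have "I * (K * inverse P) = 1 / P * I * K" for I K P :: real
        by (simp add: divide_inverse)
      ultimately show ?case
        unfolding g_def Lambda_gen_def \<alpha>_def by (simp only:)
    qed
  qed
  moreover have "eventually (\<lambda>t. eval_fps ?F t = g t) (nhds 0)" "fps_conv_radius ?F > 0"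
    using calculation(1) unfolding has_fps_expansion_def by auto
  moreover have "eventually (\<lambda>t. eval_fps ?F t = Lambda_gen \<mu> \<nu> x t) (nhds 0)"
    using calculation(2,3) by eventually_elim simp
  ultimately show ?thesis unfolding has_fps_expansion_def by blast
qed

text \<open>Only finitely many terms of the expansions of \<open>I\<close> (index \<open>p\<close>) and \<open>K\<close> (index \<open>i\<close>) reach the power \<open>t\<^sup>j\<close>,
  because both inner series vanish at \<open>t = 0\<close>.\<close>

lemma Lambda_eq_sum:
  fixes \<mu> \<nu> :: int
  assumes x: "x > 0" and \<mu>: "\<mu> \<ge> -1" and m: "\<mu> + \<nu> = 2 * int m"
  shows "Lambda \<mu> \<nu> j x = (\<Sum>p\<le>j. \<Sum>i\<le>j. fps_nth (I_norm_fps (of_int \<mu> / 2)) p * ((- 1 / 4) ^ i / fact i)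
            * Lambda_weight m j p i * (x ^ p * (x ^ (2 * i) * macdonald (of_int \<nu> / 2 + real i) (x\<^sup>2))))"
proof -
  let ?P = "fps_X * inverse (1 - fps_X :: real fps)" and ?E = "inverse ((1 - fps_X :: real fps) ^ Suc m)"
  let ?K = "Abs_fps (\<lambda>i. (- 1 / 4) ^ i / fact i * macdonald (of_int \<nu> / 2 + real i) (x\<^sup>2))"
  let ?I = "I_norm_fps (of_int \<mu> / 2)"
  have scale: "fps_nth ((fps_const (x\<^sup>2) * inverse_square_shift) ^ i * ((fps_const x * ?P) ^ p * ?E)) j
      = x ^ p * x ^ (2 * i) * Lambda_weight m j p i" for p i
  proof -
    have "(fps_const (x\<^sup>2) * inverse_square_shift) ^ i * ((fps_const x * ?P) ^ p * ?E)
        = fps_const (x ^ p * x ^ (2 * i)) * (?P ^ p * (inverse_square_shift ^ i * ?E))"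
      unfolding power_mult[of x 2 i]
      by (simp only: power_mult_distrib fps_const_power fps_const_mult[symmetric] mult_ac)
    then show ?thesis by (simp only: fps_mult_left_const_nth Lambda_weight_def)
  qed
  have "Lambda \<mu> \<nu> j x = fps_nth ((?I oo (fps_const x * ?P)) * ((?K oo (fps_const (x\<^sup>2) * inverse_square_shift)) * ?E)) j"
    unfolding Lambda_def by (rule fps_nth_eq_iterated_deriv, rule has_fps_expansion_Lambda_gen[OF x \<mu> m])
  also have "\<dots> = (\<Sum>p\<le>j. fps_nth ?I p * fps_nth ((fps_const x * ?P) ^ p * ((?K oo (fps_const (x\<^sup>2) * inverse_square_shift)) * ?E)) j)"
    by (rule nth_compose_mult) simp
  also have "\<dots> = (\<Sum>p\<le>j. fps_nth ?I p * fps_nth ((?K oo (fps_const (x\<^sup>2) * inverse_square_shift)) * ((fps_const x * ?P) ^ p * ?E)) j)"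
    by (simp only: mult.left_commute)
  also have "\<dots> = (\<Sum>p\<le>j. fps_nth ?I p * (\<Sum>i\<le>j. fps_nth ?K i * fps_nth ((fps_const (x\<^sup>2) * inverse_square_shift) ^ i * ((fps_const x * ?P) ^ p * ?E)) j))"
    by (subst nth_compose_mult) (simp_all add: power2_eq_square)
  also have "\<dots> = (\<Sum>p\<le>j. fps_nth ?I p * (\<Sum>i\<le>j. fps_nth ?K i * (x ^ p * x ^ (2 * i) * Lambda_weight m j p i)))"
    by (simp only: scale)
  finally show ?thesis
    by (simp add: sum_distrib_left mult_ac)
qed

section \<open>Moments of the coefficient functions\<close>

text \<open>If the \<open>i\<close>-th Taylor term of \<open>K\<close> is weighted by coefficients that form a known series \<open>B\<close>, the sum over \<open>i\<close> can be
  evaluated by composing \<open>B\<close> with the shift. The applications have a binomial series for \<open>B\<close>.\<close>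

lemma sum_Lambda_weight:
  "(\<Sum>i\<le>j. fps_nth B i * Lambda_weight m j p i) =
     fps_nth ((B oo inverse_square_shift) * ((fps_X * inverse (1 - fps_X)) ^ p * inverse ((1 - fps_X) ^ Suc m))) j"
  unfolding Lambda_weight_def
  by (subst nth_compose_mult) (simp_all add: power2_eq_square mult.left_commute del: power_Suc)

lemma nth_compose_X_square:
  "fps_nth (A oo fps_X ^ 2) n = (if even n then fps_nth A (n div 2) else 0)" for A :: "real fps"
proof -
  have "fps_nth (A oo fps_X ^ 2) n = (\<Sum>i=0..n. if n = 2 * i then fps_nth A i else 0)"
    unfolding fps_compose_nth by (intro sum.cong refl) (simp flip: power_mult add: fps_X_power_nth)
  also have "\<dots> = (if even n then fps_nth A (n div 2) else 0)"
  proof (cases "even n")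
    case True
    then obtain k where n: "n = 2 * k" by (elim evenE)
    have "(\<Sum>i=0..n. if n = 2 * i then fps_nth A i else 0) = (\<Sum>i=0..n. if i = k then fps_nth A i else 0)"
      by (intro sum.cong) (auto simp: n)
    then show ?thesis by (simp add: n)
  qed (auto intro!: sum.neutral)
  finally show ?thesis .
qed

text \<open>This is \<open>m! (1-t\<^sup>2)\<^bsup>-m-1\<^esup> (1-t)\<^bsup>m+1\<^esup> = m! (1+t)\<^bsup>-m-1\<^esup>\<close>, compared at \<open>t\<^sup>j\<close>.\<close>

lemma moment_fps_identity:
  "(\<Sum>p\<le>j. (if even p then fact (p div 2 + m) / fact (p div 2) else 0) * fps_nth (fps_X ^ p * (1 - fps_X) ^ Suc m) j)
     = (- 1) ^ j * fact (m + j) / (fact j :: real)"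
proof -
  define B :: "real fps" where "B = Abs_fps (\<lambda>p. if even p then fact (p div 2 + m) / fact (p div 2) else 0)"
  let ?u = "1 - fps_X :: real fps" and ?w = "1 + fps_X :: real fps"
  have "B = fps_const (fact m) * (inverse (?u ^ Suc m) oo fps_X ^ 2)"
    by (rule fps_ext, simp only: fps_mult_left_const_nth nth_compose_X_square nth_inverse_one_minus_X_power)
       (simp add: B_def add.commute)
  also have "inverse (?u ^ Suc m) oo fps_X ^ 2 = inverse ((?u ^ Suc m) oo fps_X ^ 2)"
    by (rule fps_inverse_compose) (simp_all add: power2_eq_square fps_nth_power_0)
  also have "(?u ^ Suc m) oo fps_X ^ 2 = (?u oo fps_X ^ 2) ^ Suc m"
    by (rule fps_compose_power[symmetric]) (simp add: power2_eq_square)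
  also have "?u oo fps_X ^ 2 = ?u * ?w"
    by (simp add: fps_compose_sub_distrib power2_eq_square algebra_simps)
  also have "inverse ((?u * ?w) ^ Suc m) = inverse (?u ^ Suc m) * inverse (?w ^ Suc m)"
    by (simp only: power_mult_distrib fps_inverse_mult)
  finally have B: "B = fps_const (fact m) * (inverse (?u ^ Suc m) * inverse (?w ^ Suc m))" .
  have "inverse (?u ^ Suc m) * ?u ^ Suc m = 1"
    by (rule inverse_mult_eq_1) (simp add: fps_nth_power_0)
  moreover have "B * ?u ^ Suc m = fps_const (fact m) * (inverse (?u ^ Suc m) * ?u ^ Suc m * inverse (?w ^ Suc m))"
    unfolding B by (simp only: mult_ac)
  ultimately have BH: "B * ?u ^ Suc m = fps_const (fact m) * inverse (?w ^ Suc m)"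
    by (simp only: mult_1)
  have "(\<Sum>p\<le>j. (if even p then fact (p div 2 + m) / fact (p div 2) else 0) * fps_nth (fps_X ^ p * ?u ^ Suc m) j)
      = fps_nth ((B oo fps_X) * ?u ^ Suc m) j"
    by (subst nth_compose_mult) (simp_all add: B_def del: power_Suc)
  also have "\<dots> = fact m * fps_nth (inverse (?w ^ Suc m)) j"
    by (simp only: fps_compose_fps_X BH fps_mult_left_const_nth)
  finally show ?thesis by (simp only: nth_inverse_one_plus_X_power) simp
qed

lemma fact_mult_gbinomial:
  "fact n * ((- real (Suc n)) gchoose i) = (- 1) ^ i * fact (n + i) / fact i"
proof -
  have e: "1 + real n = real (Suc n)" by simp
  have f: "fact (n + i) = (fact n * pochhammer (real (Suc n)) i :: real)"
    using pochhammer_product'[of "1::real" n i] unfolding pochhammer_fact e .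
  show ?thesis unfolding gbinomial_pochhammer minus_minus f
    by (simp add: mult_ac del: of_nat_Suc)
qed

text \<open>In the integral of the term with \<open>p = 2k\<close>, the factor \<open>\<Gamma>(k + \<mu>/2 + 1)\<close> of the Mellin transform cancels the
  denominator of the coefficient of \<open>I\<close>. The rest depends on \<open>i\<close> as the binomial series with exponent
  \<open>-(k+m+1)\<close>, so the sum over \<open>i\<close> resums to \<open>(1-t)\<^bsup>2(k+m+1)\<^esup>\<close>, and the sum over \<open>k\<close> is the preceding identity.\<close>

lemma has_bochner_integral_Lambda:
  fixes \<mu> \<nu> :: int
  assumes \<nu>: "\<nu> \<le> \<mu>" "-1 \<le> \<nu>" and m: "\<mu> + \<nu> = 2 * int m"
  shows "has_bochner_integral lborel (\<lambda>x. indicator {0<..} x * (Lambda \<mu> \<nu> j x * x ^ (2 * m + 1)))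
           (4 ^ m * ((- 1) ^ j * fact (m + j) / fact j))"
proof -
  define \<alpha> where "\<alpha> = real_of_int \<nu> / 2"
  have \<mu>: "real_of_int \<mu> / 2 = real m - \<alpha>"
  proof -
    have "real_of_int (\<mu> + \<nu>) = 2 * real m" using m by simp
    then show ?thesis by (simp add: \<alpha>_def field_simps)
  qed
  have \<mu>1: "real_of_int \<mu> / 2 \<ge> - 1 / 2" using \<nu> by simp
  define W where "W = (\<lambda>p i. fps_nth (I_norm_fps (of_int \<mu> / 2)) p * ((- 1 / 4) ^ i / fact i) * Lambda_weight m j p i)"
  define V where "V = (\<lambda>p i. 4 ^ m * ((if even p then fact (p div 2 + m) / fact (p div 2) else 0)
      * (fps_nth (fps_binomial (- real (Suc (p div 2 + m)))) i * Lambda_weight m j p i)))"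
  have "has_bochner_integral lborel
      (\<lambda>x. W p i * (indicator {0<..} x * (x ^ (p + 2 * i + 2 * m + 1) * macdonald (\<alpha> + real i) (x\<^sup>2)))) (V p i)" for p i
  proof (cases "even p")
    case True
    then obtain k where p: "p = 2 * k" by (elim evenE)
    define n where "n = k + i + m"
    define c where "c = real k + real_of_int \<mu> / 2 + 1"
    have c: "real n + 1 - (\<alpha> + real i) = c" by (simp add: n_def c_def \<mu>)
    have c0: "c > 0" using \<mu>1 by (simp add: c_def)
    have "has_bochner_integral lborel
        (\<lambda>x. W p i * (indicator {0<..} x * (x ^ (2 * n + 1) * macdonald (\<alpha> + real i) (x\<^sup>2))))
        (W p i * (4 ^ n * fact n * Gamma (real n + 1 - (\<alpha> + real i))))"
      using c c0 by (intro has_bochner_integral_mult_right has_bochner_integral_macdonald_power) linarith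
    moreover have "2 * n + 1 = p + 2 * i + 2 * m + 1" by (simp add: n_def p)
    moreover have "W p i * (4 ^ n * fact n * Gamma (real n + 1 - (\<alpha> + real i))) = V p i"
    proof -
      have G: "rGamma c * Gamma c = 1" using Gamma_real_pos[OF c0] by (simp add: rGamma_inverse_Gamma)
      have I: "fps_nth (I_norm_fps (of_int \<mu> / 2)) p = rGamma c / (fact k * 4 ^ k)"
        by (simp add: I_norm_fps_def p c_def)
      have F: "(- 1) ^ i / fact i * fact n = fact (k + m) * ((- real (Suc (k + m))) gchoose i)"
        unfolding fact_mult_gbinomial by (simp add: n_def add_ac)
      have "W p i * (4 ^ n * fact n * Gamma c) = (rGamma c * Gamma c) * (4 ^ n / 4 ^ k * (1 / 4) ^ i) *
          ((-1) ^ i / fact i * fact n / fact k * Lambda_weight m j p i)"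
        unfolding W_def I using power_mult_distrib[of "-1" "1 / 4 :: real" i] by (simp add: mult_ac)
      also have "4 ^ n / 4 ^ k * (1 / 4) ^ i = (4 ^ m :: real)"
        by (simp add: n_def power_add power_divide)
      also have "(rGamma c * Gamma c) * 4 ^ m * ((-1) ^ i / fact i * fact n / fact k * Lambda_weight m j p i) = V p i"
        unfolding G F V_def by (simp add: p)
      finally show ?thesis unfolding c .
    qed
    ultimately show ?thesis by (simp only:)
  next
    case False
    then show ?thesis by (simp add: W_def V_def I_norm_fps_def has_bochner_integral_zero)
  qed
  then have "has_bochner_integral lborel
      (\<lambda>x. \<Sum>p\<le>j. \<Sum>i\<le>j. W p i * (indicator {0<..} x * (x ^ (p + 2 * i + 2 * m + 1) * macdonald (\<alpha> + real i) (x\<^sup>2))))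
      (\<Sum>p\<le>j. \<Sum>i\<le>j. V p i)"
    by (intro has_bochner_integral_sum)
  also have "(\<lambda>x. \<Sum>p\<le>j. \<Sum>i\<le>j. W p i * (indicator {0<..} x * (x ^ (p + 2 * i + 2 * m + 1) * macdonald (\<alpha> + real i) (x\<^sup>2))))
      = (\<lambda>x. indicator {0<..} x * (Lambda \<mu> \<nu> j x * x ^ (2 * m + 1)))"
  proof
    fix x :: real
    show "(\<Sum>p\<le>j. \<Sum>i\<le>j. W p i * (indicator {0<..} x * (x ^ (p + 2 * i + 2 * m + 1) * macdonald (\<alpha> + real i) (x\<^sup>2))))
      = indicator {0<..} x * (Lambda \<mu> \<nu> j x * x ^ (2 * m + 1))"
    proof (cases "x > 0")
      case True
      have "Lambda \<mu> \<nu> j x = (\<Sum>p\<le>j. \<Sum>i\<le>j. W p i * (x ^ p * (x ^ (2 * i) * macdonald (\<alpha> + real i) (x\<^sup>2))))"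
        unfolding W_def \<alpha>_def by (rule Lambda_eq_sum[OF True _ m]) (use \<nu> in simp)
      then show ?thesis
        using True by (simp add: sum_distrib_left sum_distrib_right power_add mult_ac)
    qed simp
  qed
  also have "(\<Sum>p\<le>j. \<Sum>i\<le>j. V p i) = 4 ^ m * (\<Sum>p\<le>j. (if even p then fact (p div 2 + m) / fact (p div 2) else 0) *
      (\<Sum>i\<le>j. fps_nth (fps_binomial (- real (Suc (p div 2 + m)))) i * Lambda_weight m j p i))"
    unfolding V_def by (simp only: sum_distrib_left)
  also have "\<dots> = 4 ^ m * (\<Sum>p\<le>j. (if even p then fact (p div 2 + m) / fact (p div 2) else 0) * fps_nth (fps_X ^ p * (1 - fps_X) ^ Suc m) j)"
  proof -
    let ?u = "1 - fps_X :: real fps" and ?v = "inverse (1 - fps_X) :: real fps"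
    have uv: "?u * ?v = 1"
      by (subst mult.commute, rule inverse_mult_eq_1) simp
    have "(\<Sum>i\<le>j. fps_nth (fps_binomial (- real (Suc (k + m)))) i * Lambda_weight m j (2 * k) i)
        = fps_nth (fps_X ^ (2 * k) * ?u ^ Suc m) j" for k
    proof -
      have "?u ^ (2 * Suc (k + m)) * ((fps_X * ?v) ^ (2 * k) * inverse (?u ^ Suc m))
          = (?u * ?v) ^ (2 * k) * (?u * ?v) ^ Suc m * (fps_X ^ (2 * k) * ?u ^ Suc m)"
      proof -
        have "2 * Suc (k + m) = 2 * k + Suc m + Suc m" by simp
        then show ?thesis
          unfolding fps_inverse_power by (simp only: power_add power_mult_distrib mult_ac)
      qed
      then show ?thesis
        unfolding sum_Lambda_weight fps_binomial_compose_inverse_square_shift_nat by (simp only: uv power_one mult_1)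
    qed
    then have "(if even p then fact (p div 2 + m) / fact (p div 2) else 0) *
        (\<Sum>i\<le>j. fps_nth (fps_binomial (- real (Suc (p div 2 + m)))) i * Lambda_weight m j p i)
      = (if even p then fact (p div 2 + m) / fact (p div 2) else 0) * fps_nth (fps_X ^ p * ?u ^ Suc m) j" for p
      by (cases "even p") (auto elim!: evenE simp del: power_Suc of_nat_Suc fps_binomial_nth)
    then show ?thesis by (simp only:)
  qed
  finally show ?thesis unfolding moment_fps_identity .
qed

section \<open>Behaviour at the origin\<close>

lemma macdonald_power_eq:
  assumes x: "x > 0"
  shows "x ^ (2 * i) * macdonald (\<alpha> + real i) (x\<^sup>2) =
           x powr (- 2 * \<alpha>) * (4 powr (\<alpha> + real i) * macdonald (- (\<alpha> + real i)) (x\<^sup>2))"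
proof -
  define b where "b = \<alpha> + real i"
  have "(x\<^sup>2 / 4) powr (- b) = x powr (- b) * x powr (- b) / 4 powr (- b)"
    using x by (simp only: power2_eq_square powr_divide powr_mult)
  also have "\<dots> = x powr (- b + - b) * 4 powr b"
    unfolding powr_add by (simp add: powr_minus divide_inverse)
  also have "- b + - b = - 2 * b" by simp
  finally have "(x\<^sup>2 / 4) powr (- b) = x powr (- 2 * b) * 4 powr b" .
  moreover have "x ^ (2 * i) * x powr (- 2 * b) = x powr (- 2 * \<alpha>)"
  proof -
    have "x ^ (2 * i) * x powr (- 2 * b) = x powr (real (2 * i) + - 2 * b)"
      using x by (simp only: powr_add powr_realpow)
    also have "real (2 * i) + - 2 * b = - 2 * \<alpha>" by (simp add: b_def)
    finally show ?thesis .
  qed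
  ultimately show ?thesis
    using macdonald_reflect[of "x\<^sup>2" b] x unfolding b_def[symmetric] by (simp flip: mult.assoc)
qed

lemma tendsto_macdonald_neg:
  assumes "\<beta> > 0"
  shows "((\<lambda>x. macdonald (- \<beta>) (x\<^sup>2)) \<longlongrightarrow> Gamma \<beta> / 2) (at_right 0)"
proof (rule filterlim_compose[OF tendsto_macdonald_0[OF assms]])
  show "filterlim (\<lambda>x::real. x\<^sup>2) (at_right 0) (at_right 0)"
    unfolding filterlim_at
    by (auto intro!: tendsto_eq_intros simp: eventually_at_filter)
qed

lemma filterlim_minus_ln_half: "filterlim (\<lambda>x::real. - ln (x / 2)) at_top (at_right 0)"
proof -
  have "filterlim (\<lambda>x::real. x / 2) (at_right 0) (at_right 0)"
    unfolding filterlim_at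
    by (auto intro!: tendsto_eq_intros simp: eventually_at_filter)
  from filterlim_compose[OF ln_at_0 this] show ?thesis by (simp add: filterlim_uminus_at_top)
qed

text \<open>By l'Hospital's rule: the derivative of \<open>K\<^sub>0\<close> is, up to a factor, \<open>x\<close> times the function of order \<open>1\<close>, whose
  leading term \<open>2 / x\<^sup>2\<close> is known by reflection.\<close>

lemma tendsto_macdonald_log:
  "((\<lambda>x. macdonald 0 (x\<^sup>2) / ln (x / 2)) \<longlongrightarrow> - 1) (at_right 0)"
proof -
  have "((\<lambda>x. macdonald 0 (x\<^sup>2) / (- ln (x / 2))) \<longlongrightarrow> 1) (at_right 0)"
  proof (rule lhopital_right_0_at_top[OF filterlim_minus_ln_half])
    have ev: "eventually (\<lambda>x. x > (0::real)) (at_right 0)"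
      by (simp add: eventually_at_right_less)
    show "eventually (\<lambda>x. - 1 / x \<noteq> 0) (at_right (0::real))"
      using ev by eventually_elim simp
    show "eventually (\<lambda>x. ((\<lambda>x. macdonald 0 (x\<^sup>2)) has_real_derivative (- macdonald (0 + 1) (x\<^sup>2) / 4 * (2 * x))) (at x)) (at_right 0)"
      using ev
    proof eventually_elim
      case (elim x)
      have "((\<lambda>x. x\<^sup>2) has_real_derivative 2 * x) (at x)"
        by (auto intro!: derivative_eq_intros)
      then show ?case
        by (rule DERIV_chain2[rotated]) (rule DERIV_macdonald, use elim in simp)
    qed
    show "eventually (\<lambda>x. ((\<lambda>x. - ln (x / 2)) has_real_derivative - 1 / x) (at x)) (at_right 0)"
      using ev by eventually_elim (auto intro!: derivative_eq_intros)
    have "((\<lambda>x. 2 * macdonald (- 1) (x\<^sup>2)) \<longlongrightarrow> 2 * (Gamma 1 / 2)) (at_right 0)"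
      by (intro tendsto_intros tendsto_macdonald_neg) auto
    moreover have "eventually (\<lambda>x. 2 * macdonald (- 1) (x\<^sup>2) = - macdonald (0 + 1) (x\<^sup>2) / 4 * (2 * x) / (- 1 / x)) (at_right 0)"
      using ev
    proof eventually_elim
      case (elim x)
      have "macdonald 1 (x\<^sup>2) = x powr (- 2) * (4 * macdonald (- 1) (x\<^sup>2))"
        using macdonald_power_eq[OF elim, of 0 1] by simp
      moreover have "x powr (- 2) = 1 / x\<^sup>2"
        using elim by (simp add: powr_minus divide_inverse)
      ultimately show ?case using elim by (simp add: power2_eq_square)
    qed
    ultimately show "((\<lambda>x. - macdonald (0 + 1) (x\<^sup>2) / 4 * (2 * x) / (- 1 / x)) \<longlongrightarrow> 1) (at_right 0)"
      using Lim_transform_eventually by fastforce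
  qed
  from tendsto_minus[OF this] show ?thesis by simp
qed

lemma I_norm_fps_nth_0: "fps_nth (I_norm_fps \<alpha>) 0 = rGamma (\<alpha> + 1)"
  by (simp add: I_norm_fps_def)

text \<open>Positive powers \<open>x\<^sup>p\<close> make their terms negligible, so only the constant term of \<open>I\<close> survives.\<close>

lemma tendsto_Lambda_div:
  fixes \<mu> \<nu> :: int
  assumes \<mu>: "\<mu> \<ge> -1" and m: "\<mu> + \<nu> = 2 * int m"
    and T: "\<And>i. ((\<lambda>x. x ^ (2 * i) * macdonald (of_int \<nu> / 2 + real i) (x\<^sup>2) / \<phi> x) \<longlongrightarrow> \<tau> i) (at_right 0)"
  shows "((\<lambda>x. Lambda \<mu> \<nu> j x / \<phi> x) \<longlongrightarrow>
           rGamma (of_int \<mu> / 2 + 1) * (\<Sum>i\<le>j. ((- 1 / 4) ^ i / fact i * \<tau> i) * Lambda_weight m j 0 i)) (at_right 0)"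
proof -
  define C where "C = (\<lambda>p i. fps_nth (I_norm_fps (of_int \<mu> / 2)) p * ((- 1 / 4) ^ i / fact i) * Lambda_weight m j p i)"
  define t where "t = (\<lambda>i x. x ^ (2 * i) * macdonald (of_int \<nu> / 2 + real i) (x\<^sup>2) / \<phi> x)"
  have t: "(t i \<longlongrightarrow> \<tau> i) (at_right 0)" for i
    unfolding t_def by (rule T)
  have "((\<lambda>x. \<Sum>p\<le>j. \<Sum>i\<le>j. C p i * (x ^ p * t i x)) \<longlongrightarrow> (\<Sum>p\<le>j. \<Sum>i\<le>j. C p i * (0 ^ p * \<tau> i))) (at_right 0)"
    by (intro tendsto_intros t)
  also have "(\<Sum>p\<le>j. \<Sum>i\<le>j. C p i * (0 ^ p * \<tau> i)) = (\<Sum>p\<le>j. if p = 0 then \<Sum>i\<le>j. C 0 i * \<tau> i else 0)"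
    by (intro sum.cong) (auto simp: power_0_left)
  also have "\<dots> = rGamma (of_int \<mu> / 2 + 1) * (\<Sum>i\<le>j. ((- 1 / 4) ^ i / fact i * \<tau> i) * Lambda_weight m j 0 i)"
    by (simp add: C_def I_norm_fps_nth_0 sum_distrib_left mult_ac)
  finally have lim: "((\<lambda>x. \<Sum>p\<le>j. \<Sum>i\<le>j. C p i * (x ^ p * t i x)) \<longlongrightarrow>
      rGamma (of_int \<mu> / 2 + 1) * (\<Sum>i\<le>j. ((- 1 / 4) ^ i / fact i * \<tau> i) * Lambda_weight m j 0 i)) (at_right 0)" .
  have "eventually (\<lambda>x. x > (0::real)) (at_right 0)"
    by (simp add: eventually_at_right_less)
  then have "eventually (\<lambda>x. (\<Sum>p\<le>j. \<Sum>i\<le>j. C p i * (x ^ p * t i x)) = Lambda \<mu> \<nu> j x / \<phi> x) (at_right 0)"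
  proof eventually_elim
    case (elim x)
    show ?case
      unfolding Lambda_eq_sum[OF elim \<mu> m] C_def t_def sum_divide_distrib
      by (simp only: times_divide_eq_right)
  qed
  from Lim_transform_eventually[OF lim this] show ?thesis .
qed

text \<open>The leading coefficient of the normalized \<open>K\<close> function of order \<open>\<nu>/2\<close> relative to \<^const>\<open>B_profile\<close>.\<close>

definition profile_const :: "int \<Rightarrow> real" where
  "profile_const \<nu> = (if \<nu> > 0 then 2 powr (of_int \<nu> - 1) * Gamma (of_int \<nu> / 2)
     else if \<nu> = 0 then - 1 else sqrt pi / 2)"

text \<open>For \<open>\<nu> > 0\<close> all Taylor terms of \<open>K\<close> are of the same size \<open>x\<^bsup>-\<nu>\<^esup>\<close>. Their leading coefficients form the binomial
  series with exponent \<open>-\<nu>/2\<close>, which resums to \<open>(1-t)\<^sup>\<nu>\<close>.\<close>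

lemma tendsto_Lambda_profile_pos:
  fixes \<mu> \<nu> :: int
  assumes \<nu>: "\<nu> > 0" and m: "\<mu> + \<nu> = 2 * int m" and k: "\<mu> - \<nu> = 2 * int k"
  shows "((\<lambda>x. Lambda \<mu> \<nu> j x / x powr (- of_int \<nu>)) \<longlongrightarrow>
     rGamma (of_int \<mu> / 2 + 1) * (2 powr (of_int \<nu> - 1) * Gamma (of_int \<nu> / 2) * (fact (k + j) / (fact k * fact j)))) (at_right 0)"
proof -
  define \<alpha> where "\<alpha> = real_of_int \<nu> / 2"
  define c where "c = nat \<nu>"
  have c: "real_of_int \<nu> = real c" "m = k + c" using \<nu> m k by (auto simp: c_def)
  have \<alpha>: "\<alpha> > 0" using \<nu> by (simp add: \<alpha>_def)
  define \<tau> where "\<tau> = (\<lambda>i. 4 powr (\<alpha> + real i) * (Gamma (\<alpha> + real i) / 2))"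
  have T: "((\<lambda>x. x ^ (2 * i) * macdonald (of_int \<nu> / 2 + real i) (x\<^sup>2) / x powr (- of_int \<nu>)) \<longlongrightarrow> \<tau> i) (at_right 0)" for i
  proof -
    have "((\<lambda>x. 4 powr (\<alpha> + real i) * macdonald (- (\<alpha> + real i)) (x\<^sup>2)) \<longlongrightarrow> \<tau> i) (at_right 0)"
      unfolding \<tau>_def by (intro tendsto_intros tendsto_macdonald_neg) (use \<alpha> in simp)
    moreover have "eventually (\<lambda>x. x > (0::real)) (at_right 0)"
      by (simp add: eventually_at_right_less)
    then have "eventually (\<lambda>x. 4 powr (\<alpha> + real i) * macdonald (- (\<alpha> + real i)) (x\<^sup>2) =
        x ^ (2 * i) * macdonald (of_int \<nu> / 2 + real i) (x\<^sup>2) / x powr (- of_int \<nu>)) (at_right 0)"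
    proof eventually_elim
      case (elim x)
      have "- 2 * \<alpha> = - of_int \<nu>" by (simp add: \<alpha>_def)
      then show ?case
        unfolding \<alpha>_def[symmetric] macdonald_power_eq[OF elim] using elim by simp
    qed
    ultimately show ?thesis by (rule Lim_transform_eventually)
  qed
  have "((- 1 / 4) ^ i / fact i * \<tau> i) = 2 powr (of_int \<nu> - 1) * Gamma \<alpha> * fps_nth (fps_binomial (- \<alpha>)) i" for i
  proof -
    have "4 powr \<alpha> = (2 powr 2) powr \<alpha>" by simp
    also have "\<dots> = 2 powr of_int \<nu>" unfolding powr_powr by (simp add: \<alpha>_def)
    finally have "4 powr (\<alpha> + real i) = 2 powr of_int \<nu> * 4 ^ i"
      by (simp add: powr_add powr_realpow)
    moreover have "Gamma (\<alpha> + real i) = Gamma \<alpha> * pochhammer \<alpha> i"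
    proof -
      have "Gamma \<alpha> \<noteq> 0" using Gamma_real_pos[OF \<alpha>] by simp
      then show ?thesis
        using pochhammer_Gamma[of \<alpha> i] \<alpha> by (simp add: nonpos_Ints_def)
    qed
    moreover have "(- 1 / 4) ^ i * 4 ^ i = ((- 1) ^ i :: real)"
      by (simp flip: power_mult_distrib)
    moreover have "a / F * (P * q * (G * r / 2)) = P / 2 * G * ((a * q) * r / F)" for a F P q G r :: real
      by (simp add: mult_ac)
    ultimately show ?thesis
      unfolding \<tau>_def fps_binomial_nth gbinomial_pochhammer minus_minus powr_diff by simp
  qed
  then have "(\<Sum>i\<le>j. ((- 1 / 4) ^ i / fact i * \<tau> i) * Lambda_weight m j 0 i) =
      2 powr (of_int \<nu> - 1) * Gamma \<alpha> * (\<Sum>i\<le>j. fps_nth (fps_binomial (- \<alpha>)) i * Lambda_weight m j 0 i)"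
    by (simp only: sum_distrib_left mult.assoc)
  also have "(\<Sum>i\<le>j. fps_nth (fps_binomial (- \<alpha>)) i * Lambda_weight m j 0 i) =
      fps_nth ((fps_binomial (- real c / 2) oo inverse_square_shift) * inverse ((1 - fps_X) ^ Suc m)) j"
    unfolding sum_Lambda_weight by (simp add: \<alpha>_def c del: power_Suc)
  also have "(fps_binomial (- real c / 2) oo inverse_square_shift) * inverse ((1 - fps_X) ^ Suc m) = inverse ((1 - fps_X) ^ Suc k)"
  proof -
    let ?u = "1 - fps_X :: real fps"
    have "?u ^ c * inverse (?u ^ c) = 1"
      by (subst mult.commute, rule inverse_mult_eq_1) (simp add: fps_nth_power_0)
    moreover have "?u ^ Suc m = ?u ^ c * ?u ^ Suc k" by (simp add: c power_add mult_ac)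
    ultimately show ?thesis
      unfolding fps_binomial_compose_inverse_square_shift by (simp only: fps_inverse_mult mult.assoc[symmetric] mult_1)
  qed
  also note nth_inverse_one_minus_X_power
  finally have S: "(\<Sum>i\<le>j. ((- 1 / 4) ^ i / fact i * \<tau> i) * Lambda_weight m j 0 i) =
      2 powr (of_int \<nu> - 1) * Gamma \<alpha> * (fact (k + j) / (fact k * fact j))" .
  have "\<mu> \<ge> -1" using \<nu> k by simp
  from tendsto_Lambda_div[OF this m T, of j] show ?thesis unfolding S \<alpha>_def .
qed

text \<open>If the Taylor terms with \<open>i > 0\<close> are negligible against \<open>\<phi>\<close>, only \<open>(1-t)\<^bsup>-m-1\<^esup>\<close> remains. This covers \<open>\<nu> = 0\<close>, where
  they are bounded, and \<open>\<nu> = -1\<close>, where they are of order \<open>x\<close>.\<close>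

lemma tendsto_Lambda_profile_nonpos:
  fixes \<mu> \<nu> :: int
  assumes \<mu>: "\<mu> \<ge> -1" and m: "\<mu> + \<nu> = 2 * int m"
    and T: "\<And>i. ((\<lambda>x. x ^ (2 * i) * macdonald (of_int \<nu> / 2 + real i) (x\<^sup>2) / \<phi> x) \<longlongrightarrow> (if i = 0 then \<kappa> else 0)) (at_right 0)"
  shows "((\<lambda>x. Lambda \<mu> \<nu> j x / \<phi> x) \<longlongrightarrow>
     rGamma (of_int \<mu> / 2 + 1) * (\<kappa> * (fact (m + j) / (fact m * fact j)))) (at_right 0)"
proof -
  have "(\<Sum>i\<le>j. ((- 1 / 4) ^ i / fact i * (if i = 0 then \<kappa> else 0)) * Lambda_weight m j 0 i)
      = (\<Sum>i\<le>j. if i = 0 then \<kappa> * Lambda_weight m j 0 0 else 0)"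
    by (intro sum.cong) auto
  also have "\<dots> = \<kappa> * Lambda_weight m j 0 0" by simp
  also have "Lambda_weight m j 0 0 = fact (m + j) / (fact m * fact j)"
    unfolding Lambda_weight_def power_0 mult_1 by (rule nth_inverse_one_minus_X_power)
  finally show ?thesis using tendsto_Lambda_div[OF \<mu> m T, of j] by simp
qed

lemma tendsto_Lambda_profile:
  fixes \<mu> \<nu> :: int
  assumes \<nu>: "\<nu> \<le> \<mu>" "-1 \<le> \<nu>" and m: "\<mu> + \<nu> = 2 * int m" and k: "\<mu> - \<bar>\<nu>\<bar> = 2 * int k"
  shows "((\<lambda>x. Lambda \<mu> \<nu> j x / B_profile \<nu> x) \<longlongrightarrow>
     rGamma (of_int \<mu> / 2 + 1) * (profile_const \<nu> * (fact (k + j) / (fact k * fact j)))) (at_right 0)"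
proof -
  consider "\<nu> > 0" | "\<nu> = 0" | "\<nu> = -1" using \<nu> by linarith
  then show ?thesis
  proof cases
    case 1
    then show ?thesis
      using tendsto_Lambda_profile_pos[OF 1 m, of k j] k by (simp add: B_profile_def profile_const_def)
  next
    case 2
    have mk: "m = k" using m k 2 by simp
    have "((\<lambda>x. x ^ (2 * i) * macdonald (of_int \<nu> / 2 + real i) (x\<^sup>2) / ln (x / 2)) \<longlongrightarrow> (if i = 0 then - 1 else 0)) (at_right 0)" for i
    proof (cases "i = 0")
      case True
      then show ?thesis using tendsto_macdonald_log 2 by simp
    next
      case False
      have "((\<lambda>x. 4 powr (real i) * macdonald (- real i) (x\<^sup>2)) \<longlongrightarrow> 4 powr (real i) * (Gamma (real i) / 2)) (at_right 0)"
        by (intro tendsto_intros tendsto_macdonald_neg) (use False in simp)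
      moreover have "filterlim (\<lambda>x::real. ln (x / 2)) at_infinity (at_right 0)"
        using filterlim_minus_ln_half by (intro filterlim_at_bot_imp_at_infinity) (simp add: filterlim_uminus_at_top)
      ultimately have lim: "((\<lambda>x. 4 powr (real i) * macdonald (- real i) (x\<^sup>2) / ln (x / 2)) \<longlongrightarrow> 0) (at_right 0)"
        by (rule tendsto_divide_0)
      have "eventually (\<lambda>x. x > (0::real)) (at_right 0)"
        by (simp add: eventually_at_right_less)
      then have "eventually (\<lambda>x. 4 powr (real i) * macdonald (- real i) (x\<^sup>2) / ln (x / 2) =
          x ^ (2 * i) * macdonald (of_int \<nu> / 2 + real i) (x\<^sup>2) / ln (x / 2)) (at_right 0)"
      proof eventually_elim
        case (elim x)
        show ?case using macdonald_power_eq[OF elim, of i 0] elim 2 by simp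
      qed
      from Lim_transform_eventually[OF lim this] show ?thesis using False by simp
    qed
    from tendsto_Lambda_profile_nonpos[OF _ m this, of j] \<nu> 2 mk show ?thesis
      by (simp add: B_profile_def profile_const_def)
  next
    case 3
    have mk: "m = k" using m k 3 by simp
    have "((\<lambda>x. x ^ (2 * i) * macdonald (of_int \<nu> / 2 + real i) (x\<^sup>2) / 1) \<longlongrightarrow> (if i = 0 then sqrt pi / 2 else 0)) (at_right 0)" for i
    proof (cases "i = 0")
      case True
      then show ?thesis using tendsto_macdonald_neg[of "1 / 2"] 3 by (simp add: Gamma_one_half_real)
    next
      case False
      define b where "b = - 1 / 2 + real i"
      have "((\<lambda>x. x * (4 powr b * macdonald (- b) (x\<^sup>2))) \<longlongrightarrow> 0 * (4 powr b * (Gamma b / 2))) (at_right 0)"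
        by (intro tendsto_intros tendsto_macdonald_neg) (use False in \<open>simp add: b_def\<close>)
      then have lim: "((\<lambda>x. x * (4 powr b * macdonald (- b) (x\<^sup>2))) \<longlongrightarrow> 0) (at_right 0)" by simp
      have "eventually (\<lambda>x. x > (0::real)) (at_right 0)"
        by (simp add: eventually_at_right_less)
      then have "eventually (\<lambda>x. x * (4 powr b * macdonald (- b) (x\<^sup>2)) =
          x ^ (2 * i) * macdonald (of_int \<nu> / 2 + real i) (x\<^sup>2) / 1) (at_right 0)"
      proof eventually_elim
        case (elim x)
        have "real_of_int \<nu> / 2 = - 1 / 2" using 3 by simp
        then show ?case using macdonald_power_eq[OF elim, of i "- 1 / 2"] elim by (simp add: b_def)
      qed
      from Lim_transform_eventually[OF lim this] show ?thesis using False by simp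
    qed
    from tendsto_Lambda_profile_nonpos[OF _ m this, of j] \<nu> 3 mk show ?thesis
      by (simp add: B_profile_def profile_const_def)
  qed
qed

lemma continuous_on_Lambda:
  fixes \<mu> \<nu> :: int
  assumes \<mu>: "\<mu> \<ge> -1" and m: "\<mu> + \<nu> = 2 * int m"
  shows "continuous_on {0<..} (Lambda \<mu> \<nu> j)"
proof -
  have "continuous_on {0<..} (\<lambda>x. macdonald \<beta> (x\<^sup>2))" for \<beta>
  proof (rule continuous_on_compose2[of "{0<..}" "macdonald \<beta>"])
    show "continuous_on {0<..} (macdonald \<beta>)"
      by (intro continuous_at_imp_continuous_on ballI DERIV_isCont[OF DERIV_macdonald]) simp
  qed (auto intro!: continuous_intros)
  then have "continuous_on {0<..} (\<lambda>x. \<Sum>p\<le>j. \<Sum>i\<le>j. fps_nth (I_norm_fps (of_int \<mu> / 2)) p * ((- 1 / 4) ^ i / fact i)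
            * Lambda_weight m j p i * (x ^ p * (x ^ (2 * i) * macdonald (of_int \<nu> / 2 + real i) (x\<^sup>2))))"
    by (intro continuous_intros)
  then show ?thesis
    by (rule continuous_on_cong[THEN iffD1, rotated -1, OF _ refl]) (simp add: Lambda_eq_sum[OF _ \<mu> m])
qed

section \<open>Gegenbauer polynomials at 1\<close>

lemma gegenbauer_1: "gegenbauer n l 1 = pochhammer (2 * l) n / fact n"
proof (induction n rule: induct_nat_012)
  case (ge2 n)
  have "gegenbauer (Suc (Suc n)) l 1 =
      (2 * (real n + 1 + l) * (pochhammer (2 * l) (Suc n) / fact (Suc n)) - (real n + 2 * l) * (pochhammer (2 * l) n / fact n)) / (real n + 2)"
    using ge2 by simp
  also have "\<dots> = pochhammer (2 * l) n * (2 * l + real n) * (2 * l + real n + 1) / fact n / ((real n + 1) * (real n + 2))"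
  proof -
    have "(2 * (N + 1 + l) * (P * (2 * l + N) / ((N + 1) * F)) - (N + 2 * l) * (P / F)) / (N + 2)
        = P * (2 * l + N) * (2 * l + N + 1) / F / ((N + 1) * (N + 2))" if "N + 1 \<noteq> 0" "N + 2 \<noteq> 0" "F \<noteq> 0" for N P F :: real
      using that by (simp add: divide_simps) (simp add: algebra_simps)
    from this[of "real n" "fact n" "pochhammer (2 * l) n"] show ?thesis
      by (simp add: pochhammer_Suc fact_Suc add.commute)
  qed
  also have "\<dots> = pochhammer (2 * l) (Suc (Suc n)) / fact (Suc (Suc n))"
    by (simp add: pochhammer_Suc fact_Suc divide_inverse mult_ac add_ac)
  finally show ?case .
qed auto

lemma gegenbauer_norm_1:
  assumes "l > 0"
  shows "gegenbauer_norm n l 1 = Gamma l * Gamma (2 * l + real n) / (Gamma (2 * l) * fact n)"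
  using assms pochhammer_Gamma[of "2 * l" n]
  by (simp add: gegenbauer_norm_def gegenbauer_1 nonpos_Ints_def)

text \<open>The pole of \<open>\<Gamma>\<close> at \<open>0\<close> is cancelled by the factor \<open>2s\<close> of the rising factorial of \<open>2s\<close>.\<close>

lemma gegenbauer_norm_0_1:
  assumes "n > 0"
  shows "gegenbauer_norm n 0 1 = 2 / real n"
proof -
  obtain k where n: "n = Suc k" using assms gr0_conv_Suc by blast
  have "((\<lambda>s::real. Gamma (s + 1) * (2 * pochhammer (2 * s + 1) k / fact n)) \<longlongrightarrow>
      Gamma (0 + 1) * (2 * pochhammer (2 * 0 + 1) k / fact n)) (at 0)"
    unfolding pochhammer_prod by (intro tendsto_intros) auto
  also have "Gamma (0 + 1) * (2 * pochhammer (2 * 0 + 1) k / fact n) = 2 / real n"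
    by (simp add: n flip: pochhammer_fact)
  finally have lim: "((\<lambda>s::real. Gamma (s + 1) * (2 * pochhammer (2 * s + 1) k / fact n)) \<longlongrightarrow> 2 / real n) (at 0)" .
  have "eventually (\<lambda>s. s \<in> {-1<..<1} - {0::real}) (at 0)"
    by (rule eventually_at_in_open) auto
  then have "eventually (\<lambda>s. Gamma (s + 1) * (2 * pochhammer (2 * s + 1) k / fact n) = Gamma s * gegenbauer n s 1) (at 0)"
  proof eventually_elim
    case (elim s)
    have "s \<notin> \<int>\<^sub>\<le>\<^sub>0" using elim by (auto elim!: nonpos_Ints_cases)
    then show ?case
      by (simp add: Gamma_plus1 gegenbauer_1 n pochhammer_rec)
  qed
  from Lim_transform_eventually[OF lim this] have "Lim (at 0) (\<lambda>s. Gamma s * gegenbauer n s 1) = 2 / real n"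
    by (intro tendsto_Lim) auto
  then show ?thesis
    unfolding gegenbauer_norm_def by simp
qed

text \<open>Legendre's duplication formula removes the quotient \<open>\<Gamma>(\<lambda>) / \<Gamma>(2\<lambda>)\<close>. In this form the value at \<open>\<lambda> = 0\<close> needs no
  separate expression.\<close>

lemma gegenbauer_norm_1_half:
  fixes \<nu> :: int
  assumes "\<nu> \<ge> -1" "\<nu> = -1 \<Longrightarrow> n > 0"
  shows "gegenbauer_norm n (of_int (\<nu> + 1) / 2) 1 =
     sqrt pi * 2 powr (- of_int \<nu>) * Gamma (real n + of_int \<nu> + 1) / (fact n * Gamma (of_int \<nu> / 2 + 1))"
proof (cases "\<nu> = -1")
  case True
  then have n: "n > 0" using assms by simp
  then obtain k where k: "n = Suc k" using gr0_conv_Suc by blast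
  have "Gamma (1 + real k) = fact k" "Gamma (real k + 1) = fact k"
    using Gamma_fact[of k, where 'a = real] by (simp_all add: add.commute)
  then show ?thesis
    using True n by (simp add: gegenbauer_norm_0_1 Gamma_one_half_real k)
next
  case False
  define l where "l = real_of_int (\<nu> + 1) / 2"
  have l: "l > 0" using False assms by (simp add: l_def)
  have dup: "Gamma l * Gamma (l + 1 / 2) = 2 powr (1 - 2 * l) * sqrt pi * Gamma (2 * l)"
  proof -
    have c: "complex_of_real l + 1 / 2 = complex_of_real (l + 1 / 2)" "2 * complex_of_real l = complex_of_real (2 * l)"
        "(1 - complex_of_real (2 * l)) * complex_of_real (ln 2) = complex_of_real ((1 - 2 * l) * ln 2)"
      by simp_all
    have "complex_of_real l \<notin> \<int>\<^sub>\<le>\<^sub>0" "complex_of_real (l + 1 / 2) \<notin> \<int>\<^sub>\<le>\<^sub>0"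
      unfolding of_real_in_nonpos_Ints_iff using l by (auto simp: nonpos_Ints_def)
    from Gamma_legendre_duplication[of "complex_of_real l", unfolded c(1), OF this]
    have "complex_of_real (Gamma l) * complex_of_real (Gamma (l + 1 / 2)) =
        complex_of_real (exp ((1 - 2 * l) * ln 2)) * complex_of_real (sqrt pi) * complex_of_real (Gamma (2 * l))"
      unfolding c Gamma_complex_of_real exp_of_real .
    then show ?thesis unfolding of_real_mult[symmetric] of_real_eq_iff by (simp add: powr_def)
  qed
  have G: "Gamma (l + 1 / 2) > 0" "Gamma (2 * l) > 0" using l by (auto intro: Gamma_real_pos)
  have "gegenbauer_norm n l 1 = (Gamma l * Gamma (l + 1 / 2)) * Gamma (2 * l + real n) / (Gamma (l + 1 / 2) * Gamma (2 * l) * fact n)"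
    using gegenbauer_norm_1[OF l, of n] G by simp
  also have "\<dots> = 2 powr (1 - 2 * l) * sqrt pi * Gamma (2 * l + real n) / (Gamma (l + 1 / 2) * fact n)"
    unfolding dup using G by simp
  also have "1 - 2 * l = - of_int \<nu>" by (simp add: l_def field_simps)
  also have "2 * l + real n = real n + of_int \<nu> + 1" by (simp add: l_def field_simps)
  also have "l + 1 / 2 = of_int \<nu> / 2 + 1" by (simp add: l_def field_simps)
  finally show ?thesis by (simp add: l_def mult_ac)
qed

text \<open>The reciprocal Gamma factors on the right are the values of the two Bessel factors at \<open>0\<close>, which
  therefore cancel in the computation of \<open>A\<close>.\<close>

lemma gegenbauer_norm_1_product:
  fixes \<mu> \<nu> :: int
  assumes \<nu>: "\<nu> \<le> \<mu>" "-1 \<le> \<nu>" "\<mu> \<noteq> -1" and m: "\<mu> + \<nu> = 2 * int m" and l: "\<mu> - \<nu> = 2 * int l"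
  shows "gegenbauer_norm j (of_int (\<mu> + 1) / 2) 1 * gegenbauer_norm (j + l) (of_int (\<nu> + 1) / 2) 1 =
    pi * Gamma (real j + of_int \<mu> + 1) * fact (m + j) * rGamma (of_int \<mu> / 2 + 1) * rGamma (of_int \<nu> / 2 + 1)
      / (4 ^ m * fact j * fact (j + l))"
proof -
  have 1: "gegenbauer_norm j (of_int (\<mu> + 1) / 2) 1 =
     sqrt pi * 2 powr (- of_int \<mu>) * Gamma (real j + of_int \<mu> + 1) / (fact j * Gamma (of_int \<mu> / 2 + 1))"
    by (rule gegenbauer_norm_1_half) (use \<nu> in auto)
  have 2: "gegenbauer_norm (j + l) (of_int (\<nu> + 1) / 2) 1 =
     sqrt pi * 2 powr (- of_int \<nu>) * Gamma (real (j + l) + of_int \<nu> + 1) / (fact (j + l) * Gamma (of_int \<nu> / 2 + 1))"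
    by (rule gegenbauer_norm_1_half) (use \<nu> l in auto)
  have "int l + \<nu> = int m" using m l by linarith
  then have "real l + of_int \<nu> = real m" by linarith
  then have "real (j + l) + of_int \<nu> + 1 = 1 + real (m + j)" by simp
  then have 3: "Gamma (real (j + l) + of_int \<nu> + 1) = fact (m + j)" by (simp only: Gamma_fact)
  have "2 powr (- of_int \<mu>) * 2 powr (- of_int \<nu>) = 2 powr (- real_of_int (\<mu> + \<nu>))"
    by (simp flip: powr_add)
  also have "\<dots> = inverse (2 powr real (2 * m))" unfolding m powr_minus by simp
  also have "\<dots> = inverse (4 ^ m)" unfolding powr_realpow[OF zero_less_numeral] power_mult by simp
  finally have 4: "2 powr (- of_int \<mu>) * 2 powr (- of_int \<nu>) = inverse (4 ^ m :: real)" .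
  have gen: "s * p * G / (F * g) * (s * q * M / (H * h)) = (s * s) * G * M * inverse g * inverse h * (p * q) / (F * H)"
    for s p G F g q M H h :: real
    by (simp add: divide_inverse mult_ac)
  have "sqrt pi * sqrt pi = pi" by simp
  then show ?thesis
    unfolding 1 2 3 gen 4 rGamma_inverse_Gamma by (simp only: divide_inverse inverse_mult_distrib mult_ac)
qed

section \<open>The two constants\<close>

lemma J_norm_0: "J_norm \<alpha> 0 = rGamma (\<alpha> + 1)"
proof -
  have "J_norm \<alpha> 0 = (\<Sum>k\<in>{0}. (-1) ^ k * rGamma (real k + \<alpha> + 1) / fact k * (0 / 2) ^ (2 * k))"
    unfolding J_norm_def by (rule suminf_finite) auto
  then show ?thesis by simp
qed

lemma AE_wmeasure_iff:
  "(AE x in wmeasure \<mu> \<nu>. P x) \<longleftrightarrow> (AE x in lborel. x > 0 \<longrightarrow> P x)"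
proof -
  have "(AE x in wmeasure \<mu> \<nu>. P x) \<longleftrightarrow>
      (AE x in restrict_space lborel {0<..}. 0 < ennreal (x powr of_int (\<mu> + \<nu> + 1)) \<longrightarrow> P x)"
    unfolding wmeasure_def by (rule AE_density) (intro measurable_restrict_space1, measurable)
  also have "\<dots> \<longleftrightarrow> (AE x in lborel. x \<in> {0<..} \<longrightarrow> 0 < ennreal (x powr of_int (\<mu> + \<nu> + 1)) \<longrightarrow> P x)"
    by (rule AE_restrict_space_iff) simp
  finally show ?thesis by (auto simp: ennreal_less_zero_iff elim!: eventually_mono)
qed

text \<open>The set where two continuous functions differ is open, and a non-empty open set is not negligible.\<close>

lemma eq_of_AE_eq_continuous_on_open:
  fixes f g :: "real \<Rightarrow> complex"
  assumes f: "continuous_on S f" and g: "continuous_on S g" and S: "open S"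
    and ae: "AE x in lborel. x \<in> S \<longrightarrow> f x = g x" and x: "x \<in> S"
  shows "f x = g x"
proof (rule ccontr)
  assume ne: "f x \<noteq> g x"
  define U where "U = {x \<in> S. f x - g x \<noteq> 0}"
  have "open (S \<inter> (\<lambda>x. f x - g x) -` (- {0}))"
    by (intro continuous_open_preimage S continuous_on_diff f g) auto
  also have "S \<inter> (\<lambda>x. f x - g x) -` (- {0}) = U" by (auto simp: U_def)
  finally have "open U" .
  moreover have "U \<noteq> {}" using ne x by (auto simp: U_def)
  moreover have "negligible U"
  proof -
    obtain N where "{x \<in> space lborel. \<not> (x \<in> S \<longrightarrow> f x = g x)} \<subseteq> N" "N \<in> null_sets lborel"
      using ae by (auto elim!: AE_E simp: null_sets_def)
    then show ?thesis
      by (intro negligible_subset[of N U]) (auto simp: U_def negligible_iff_null_sets null_sets_completionI)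
  qed
  ultimately show False using open_not_negligible by blast
qed

lemma integral_wmeasure_Lambda:
  fixes \<mu> \<nu> :: int
  assumes \<nu>: "\<nu> \<le> \<mu>" "-1 \<le> \<nu>" and m: "\<mu> + \<nu> = 2 * int m"
  shows "(LINT x|wmeasure \<mu> \<nu>. Lambda \<mu> \<nu> j x) = 4 ^ m * ((- 1) ^ j * fact (m + j) / fact j)"
proof -
  have "\<mu> \<ge> -1" using \<nu> by simp
  note cont = continuous_on_Lambda[OF this m, of j]
  have meas: "Lambda \<mu> \<nu> j \<in> borel_measurable (restrict_space lborel {0<..})"
  proof -
    have sets: "sets (restrict_space lborel {0<..}) = sets (restrict_space borel {0::real<..})"
      by (simp add: sets_restrict_space)
    show ?thesis
      unfolding measurable_cong_sets[OF sets refl]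
      by (rule borel_measurable_continuous_on_restrict[OF cont])
  qed
  have "(LINT x|wmeasure \<mu> \<nu>. Lambda \<mu> \<nu> j x) =
      (LINT x|restrict_space lborel {0<..}. x powr of_int (\<mu> + \<nu> + 1) *\<^sub>R Lambda \<mu> \<nu> j x)"
    unfolding wmeasure_def
    by (rule integral_density[OF meas]) (auto intro!: measurable_restrict_space1)
  also have "\<dots> = (LBINT x. indicator {0<..} x *\<^sub>R (x powr of_int (\<mu> + \<nu> + 1) *\<^sub>R Lambda \<mu> \<nu> j x))"
    by (rule integral_restrict_space) simp
  also have "\<dots> = (LBINT x. indicator {0<..} x * (Lambda \<mu> \<nu> j x * x ^ (2 * m + 1)))"
  proof (intro Bochner_Integration.integral_cong refl)
    fix x :: real
    have e: "real_of_int (\<mu> + \<nu> + 1) = real (2 * m + 1)" using m by simp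
    show "indicator {0<..} x *\<^sub>R (x powr of_int (\<mu> + \<nu> + 1) *\<^sub>R Lambda \<mu> \<nu> j x) =
        indicator {0<..} x * (Lambda \<mu> \<nu> j x * x ^ (2 * m + 1))"
      unfolding e by (cases "x > 0") (auto simp: powr_realpow simp del: of_nat_add of_nat_mult of_nat_Suc)
  qed
  also have "\<dots> = 4 ^ m * ((- 1) ^ j * fact (m + j) / fact j)"
    using has_bochner_integral_Lambda[OF \<nu> m, of j] by (simp add: has_bochner_integral_iff)
  finally show ?thesis .
qed

lemma eventually_B_profile_nonzero: "eventually (\<lambda>x. B_profile \<nu> x \<noteq> 0) (at_right 0)"
proof -
  have "eventually (\<lambda>x. x \<in> {0<..<1}) (at_right (0::real))"
    by (rule eventually_at_right_real) simp
  then show ?thesis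
    by eventually_elim (auto simp: B_profile_def)
qed

lemma is_const_B_tendsto:
  assumes "is_const_B \<nu> u B"
  shows "((\<lambda>x. u x / of_real (B_profile \<nu> x)) \<longlongrightarrow> B) (at_right 0)"
proof -
  from assms obtain r where r: "r \<in> o[at_right 0](\<lambda>x. complex_of_real (B_profile \<nu> x))"
    and u: "\<And>x. x > 0 \<Longrightarrow> u x = B * (of_real (B_profile \<nu> x) + r x)"
    unfolding is_const_B_def by blast
  have "((\<lambda>x. B * (1 + r x / of_real (B_profile \<nu> x))) \<longlongrightarrow> B * (1 + 0)) (at_right 0)"
    by (intro tendsto_intros smalloD_tendsto[OF r])
  then have lim: "((\<lambda>x. B * (1 + r x / of_real (B_profile \<nu> x))) \<longlongrightarrow> B) (at_right 0)" by simp
  have "eventually (\<lambda>x. x > (0::real)) (at_right 0)"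
    by (simp add: eventually_at_right_less)
  with eventually_B_profile_nonzero[of \<nu>]
  have "eventually (\<lambda>x. B * (1 + r x / of_real (B_profile \<nu> x)) = u x / of_real (B_profile \<nu> x)) (at_right 0)"
    by eventually_elim (simp add: u field_simps)
  from Lim_transform_eventually[OF lim this] show ?thesis .
qed

text \<open>The defining identity of \<open>A\<close> at \<open>\<theta> = \<phi> = 0\<close>. The Gegenbauer values there are non-zero, so this single point
  determines \<open>A\<close>.\<close>

lemma is_const_A_at_zero:
  fixes \<mu> \<nu> :: int and c A :: complex
  assumes \<nu>: "\<nu> \<le> \<mu>" "-1 \<le> \<nu>" "\<mu> \<noteq> -1" and m: "\<mu> + \<nu> = 2 * int m" and l: "\<mu> - \<nu> = 2 * int l"
    and u: "\<And>x. x > 0 \<Longrightarrow> u x = c * of_real (Lambda \<mu> \<nu> j x)"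
    and A: "is_const_A \<mu> \<nu> j u A"
  shows "A = c * of_real ((- 1) ^ j * 16 ^ m * fact (j + l) / (pi * Gamma (real j + of_int \<mu> + 1)))"
proof -
  define R where "R = rGamma (real_of_int \<mu> / 2 + 1) * rGamma (real_of_int \<nu> / 2 + 1)"
  define G where "G = Gamma (real j + of_int \<mu> + 1)"
  have R: "R \<noteq> 0"
  proof -
    have "real_of_int \<mu> / 2 + 1 > 0" "real_of_int \<nu> / 2 + 1 > 0" using \<nu> by auto
    from this[THEN Gamma_real_pos] show ?thesis by (simp add: R_def rGamma_inverse_Gamma)
  qed
  have G: "G > 0" unfolding G_def by (rule Gamma_real_pos) (use \<nu> in simp)
  have n: "nat (int j + (\<mu> - \<nu>) div 2) = j + l" using l by simp
  have one: "((1 + 1) / 2 :: real) powr e = 1" for e by simp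
  have "(LINT x|wmeasure \<mu> \<nu>. u x * of_real (J_norm (of_int \<mu> / 2) 0) * of_real (J_norm (of_int \<nu> / 2) 0)) =
      A * of_real (gegenbauer_norm j (of_int (\<mu> + 1) / 2) 1 * gegenbauer_norm (j + l) (of_int (\<nu> + 1) / 2) 1)"
    using A[unfolded is_const_A_def, rule_format, of 0 0] by (simp add: Let_def n)
  also have "(LINT x|wmeasure \<mu> \<nu>. u x * of_real (J_norm (of_int \<mu> / 2) 0) * of_real (J_norm (of_int \<nu> / 2) 0)) =
      (LINT x|wmeasure \<mu> \<nu>. c * of_real R * of_real (Lambda \<mu> \<nu> j x))"
    by (intro Bochner_Integration.integral_cong refl)
       (simp add: wmeasure_def space_restrict_space u J_norm_0 R_def mult_ac)
  also have "\<dots> = c * of_real (R * (4 ^ m * ((- 1) ^ j * fact (m + j) / fact j)))"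
    by (simp add: integral_wmeasure_Lambda[OF \<nu>(1,2) m] mult_ac flip: of_real_mult)
  also have "gegenbauer_norm j (of_int (\<mu> + 1) / 2) 1 * gegenbauer_norm (j + l) (of_int (\<nu> + 1) / 2) 1
      = pi * G * fact (m + j) * R / (4 ^ m * fact j * fact (j + l))"
    unfolding gegenbauer_norm_1_product[OF \<nu> m l] by (simp add: R_def G_def mult.assoc)
  finally have eq: "A * of_real (pi * G * fact (m + j) * R / (4 ^ m * fact j * fact (j + l))) =
      c * of_real (R * (4 ^ m * ((- 1) ^ j * fact (m + j) / fact j)))" by simp
  define q where "q = pi * G * fact (m + j) * R / (4 ^ m * fact j * fact (j + l))"
  have q: "q \<noteq> 0" using R G by (simp add: q_def)
  have "R * (4 ^ m * ((- 1) ^ j * fact (m + j) / fact j)) =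
      ((- 1) ^ j * 16 ^ m * fact (j + l) / (pi * G)) * q"
  proof -
    have "(16::real) ^ m = 4 ^ m * 4 ^ m" by (simp flip: power_mult_distrib)
    moreover have "R * (f * (s * M / J)) = (s * (f * f) * L / (p * G)) * (p * G * M * R / (f * J * L))"
      if "f \<noteq> 0" "p \<noteq> 0" "L \<noteq> 0" for f s M J L p :: real
      using that G by simp
    ultimately show ?thesis by (simp only: q_def pi_neq_zero fact_nonzero power_not_zero zero_neq_numeral not_False_eq_True)
  qed
  with eq have "A * of_real q = c * of_real ((- 1) ^ j * 16 ^ m * fact (j + l) / (pi * G)) * of_real q"
    unfolding q_def[symmetric] by (simp only: of_real_mult mult.assoc)
  moreover have "complex_of_real q \<noteq> 0" using q by simp
  ultimately show ?thesis unfolding G_def by (metis mult_right_cancel)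
qed

lemma profile_const_c_const:
  assumes "\<nu> \<ge> -1"
  shows "1 / profile_const \<nu> = 2 powr (- of_int \<nu>) * c_const \<nu>"
proof -
  consider "\<nu> > 0" | "\<nu> = 0" | "\<nu> = -1" using assms by linarith
  then show ?thesis
  proof cases
    case 1
    have e: "2 powr (real_of_int \<nu> - 1) = 2 powr of_int \<nu> / 2" "2 powr (- real_of_int \<nu>) = 1 / 2 powr of_int \<nu>"
      by (simp_all add: powr_diff powr_minus_divide)
    show ?thesis using 1 by (simp add: profile_const_def c_const_def e)
  next
    case 2
    then show ?thesis by (simp add: profile_const_def c_const_def)
  next
    case 3
    have "(-1 / 2 :: real) \<notin> \<int>\<^sub>\<le>\<^sub>0"
    proof
      assume "(-1 / 2 :: real) \<in> \<int>\<^sub>\<le>\<^sub>0"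
      then obtain n where "-1 / 2 = real_of_int n" by (elim nonpos_Ints_cases)
      then have "real_of_int (2 * n) = real_of_int (- 1)" by simp
      then have "2 * n = - 1" by (simp only: of_int_eq_iff)
      then show False by presburger
    qed
    then have "sqrt pi = - 1 / 2 * Gamma (- 1 / 2)"
      using Gamma_plus1[of "-1 / 2 :: real"] by (simp add: Gamma_one_half_real)
    then have "Gamma (- 1 / 2) = - 2 * sqrt pi" by simp
    then show ?thesis using 3 by (simp add: profile_const_def c_const_def)
  qed
qed

theorem theoremB:
  fixes \<mu> \<nu> :: int and j :: nat
    and T :: "((real \<Rightarrow> complex) \<times> (real \<Rightarrow> complex)) set"
    and u :: "real \<Rightarrow> complex" and A B :: complex
  assumes "\<mu> \<ge> \<nu>" and "\<nu> \<ge> -1" and "even (\<mu> - \<nu>)" and "\<not> (\<mu> = -1 \<and> \<nu> = -1)"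
    and "D_realization \<mu> \<nu> T"
    and "L2_solution \<mu> \<nu> T j u" and "\<exists>x>0. u x \<noteq> 0"
    and "is_const_A \<mu> \<nu> j u A" and "is_const_B \<nu> u B"
  shows "A / B = of_real (
     (-1) ^ j * (fact j * 2 powi (2 * \<mu> + \<nu>)
         * Gamma (of_int (\<mu> + 2) / 2) * Gamma (of_int (\<mu> - \<bar>\<nu>\<bar> + 2) / 2)
         * Gamma (real j + of_int (\<mu> - \<nu> + 2) / 2))
       / (Gamma (real j + of_int (\<mu> - \<bar>\<nu>\<bar> + 2) / 2) * pi * Gamma (real j + of_int \<mu> + 1))
     * c_const \<nu>)"
proof -
  have even: "even (\<mu> + \<nu>)" "even (\<mu> - \<bar>\<nu>\<bar>)" using assms(3) by (auto simp: abs_if)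
  have nonneg: "0 \<le> \<mu> + \<nu>" "0 \<le> \<mu> - \<nu>" "0 \<le> \<mu> - \<bar>\<nu>\<bar>" "\<mu> \<noteq> -1"
    using assms(1-4) by (auto simp: abs_if) presburger+
  obtain m l k where m: "\<mu> + \<nu> = 2 * int m" and l: "\<mu> - \<nu> = 2 * int l" and k: "\<mu> - \<bar>\<nu>\<bar> = 2 * int k"
    using even assms(3) nonneg by (metis evenE nonneg_int_cases zero_le_mult_iff zero_less_numeral not_le)
  have "u \<in> eigenspace T (of_int (D_eigenvalue \<mu> j))" and cont: "continuous_on {0<..} u"
    using assms(6) by (auto simp: L2_solution_def)
  then obtain c where "AE x in wmeasure \<mu> \<nu>. u x = c * of_real (Lambda \<mu> \<nu> j x)"
    using assms(5) by (auto simp: D_realization_def)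
  then have ae: "AE x in lborel. x \<in> {0<..} \<longrightarrow> u x = c * of_real (Lambda \<mu> \<nu> j x)"
    by (simp add: AE_wmeasure_iff)
  have "\<mu> \<ge> -1" using assms(1,2) by simp
  then have "continuous_on {0<..} (\<lambda>x. c * of_real (Lambda \<mu> \<nu> j x))"
    by (intro continuous_intros continuous_on_Lambda[OF _ m])
  from eq_of_AE_eq_continuous_on_open[OF cont this _ ae]
  have u: "u x = c * of_real (Lambda \<mu> \<nu> j x)" if "x > 0" for x using that by simp
  define P where "P = rGamma (real_of_int \<mu> / 2 + 1) * (profile_const \<nu> * (fact (k + j) / (fact k * fact j)))"
  have "((\<lambda>x. c * of_real (Lambda \<mu> \<nu> j x / B_profile \<nu> x)) \<longlongrightarrow> c * of_real P) (at_right 0)"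
    unfolding P_def by (intro tendsto_intros tendsto_Lambda_profile[OF assms(1,2) m k])
  moreover have "eventually (\<lambda>x. c * of_real (Lambda \<mu> \<nu> j x / B_profile \<nu> x) = u x / of_real (B_profile \<nu> x)) (at_right 0)"
    using eventually_at_right_less[of "0::real"] by eventually_elim (simp add: u)
  ultimately have "((\<lambda>x. u x / of_real (B_profile \<nu> x)) \<longlongrightarrow> c * of_real P) (at_right 0)"
    by (rule Lim_transform_eventually)
  then have B: "B = c * of_real P"
    using is_const_B_tendsto[OF assms(9)] tendsto_unique trivial_limit_at_right_real by blast
  have "B \<noteq> 0" using assms(9) by (simp add: is_const_B_def)
  then have c: "c \<noteq> 0" by (auto simp: B)
  define G where "G = Gamma (real j + of_int \<mu> + 1)"
  have "A / B = of_real ((- 1) ^ j * 16 ^ m * fact (j + l) / (pi * G) / P)"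
  proof -
    have "A = c * of_real ((- 1) ^ j * 16 ^ m * fact (j + l) / (pi * G))"
      unfolding G_def by (rule is_const_A_at_zero[OF assms(1,2) nonneg(4) m l u assms(8)])
    then show ?thesis unfolding B using c by (simp add: mult.assoc)
  qed
  also have "(- 1) ^ j * 16 ^ m * fact (j + l) / (pi * G) / P =
      (-1) ^ j * (fact j * (16 ^ m * 2 powr (- of_int \<nu>)) * Gamma (real_of_int \<mu> / 2 + 1) * fact k * fact (j + l))
       / (fact (j + k) * pi * G) * c_const \<nu>"
  proof -
    have "a * b * d / (pi * G) / (inverse g * (p * (F / (K * J)))) = a * (J * (b * q) * g * K * d) / (F * pi * G) * e"
      if "1 / p = q * e" for a b d g p F K J q e :: real
    proof -
      have "a * b * d / (pi * G) / (inverse g * (p * (F / (K * J)))) = a * b * d * g * K * J / (F * pi * G) * (1 / p)"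
        by (simp add: divide_inverse mult_ac)
      then show ?thesis unfolding that by (simp add: mult_ac)
    qed
    from this[OF profile_const_c_const[OF assms(2)]] show ?thesis
      unfolding P_def rGamma_inverse_Gamma add.commute[of k j] .
  qed
  also have "16 ^ m * 2 powr (- of_int \<nu>) = (2 powi (2 * \<mu> + \<nu>) :: real)"
  proof -
    have "(16::real) ^ m = 2 powi (4 * int m)"
      by (simp add: power_int_mult)
    moreover have "2 powr (- of_int \<nu>) = (2 powi (- \<nu>) :: real)"
      by (simp add: powr_real_of_int' flip: of_int_minus)
    moreover have "4 * int m + - \<nu> = 2 * \<mu> + \<nu>" using m by simp
    ultimately show ?thesis by (metis power_int_add zero_neq_numeral)
  qed
  also have "Gamma (real_of_int \<mu> / 2 + 1) = Gamma (of_int (\<mu> + 2) / 2)"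
    by (simp add: add_divide_distrib)
  also have "fact k = Gamma (real_of_int (\<mu> - \<bar>\<nu>\<bar> + 2) / 2)"
    unfolding k using Gamma_fact[of k, where 'a = real] by (simp add: add_divide_distrib add.commute)
  also have "fact (j + l) = Gamma (real j + of_int (\<mu> - \<nu> + 2) / 2)"
    unfolding l using Gamma_fact[of "j + l", where 'a = real] by (simp add: add_divide_distrib add_ac)
  also have "fact (j + k) = Gamma (real j + of_int (\<mu> - \<bar>\<nu>\<bar> + 2) / 2)"
    unfolding k using Gamma_fact[of "j + k", where 'a = real] by (simp add: add_divide_distrib add_ac)
  finally show ?thesis unfolding G_def .
qed

end
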